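(* The cycle index series of hollow hypertrees decorated by $\widehat{\operatorname{PreLie}}$ is $$Z^h_{\widehat{\operatorname{PreLie}}}= \frac{1}{1+t}\,\operatorname{PreLie} \circ (1+t)\, p_1 ,$$ that is, $Z^h_{\widehat{\operatorname{PreLie}}}(t,p_1,p_2,\ldots)=\frac{1}{1+t}\operatorname{PreLie}\bigl((1+t)p_1,(1+t^2)p_2,\ldots,(1+t^k)p_k,\ldots\bigr)$.
   Context: A hypergraph on a finite set $V$ is a pair $(V,E)$ with $E$ a set of subsets of $V$ of cardinality at least two (the edges). A hypertree on $V$ is a hypergraph with $V\neq\emptyset$ whose bipartite incidence graph (on $V\sqcup E$) is a tree. A hollow hypertree on $I$ is a hypertree on $\{\#\}\sqcup I$ such that $\#$ (the gap) belongs to exactly one edge. The petiole of an edge is its vertex nearest to the gap (the gap itself for the edge containing it). A hollow hypertree decorated by $\widehat{\operatorname{PreLie}}$ on $I$ is a hollow hypertree on $\{\#\}\sqcup I$ together with, for every edge $e$, a rooted tree whose vertex set is the set of vertices of $e$ different from the petiole. Its weight is $t^{|E|-1}$, $E$ being the set of edges of the hypertree. The weighted cycle index series of a weighted species $F$ is $\sum_{n\ge0}\frac1{n!}\sum_{\sigma\in\mathfrak S_n}\bigl(\sum_{s\in F(\{1,\dots,n\})^\sigma} w(s)\bigr)\prod_{i\ge1}p_i^{\sigma_i}$, where $F(\{1,\dots,n\})^\sigma$ is the set of structures fixed by $\sigma$ and $\sigma_i$ is the number of cycles of length $i$ of $\sigma$. $\operatorname{PreLie}=\operatorname{PreLie}(p_1,p_2,\ldots)$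 denotes the (unweighted) cycle index series of the species of rooted trees. Plethystic substitution is $f\circ g=f\bigl(g(t,p_1,p_2,\ldots),g(t^2,p_2,p_4,\ldots),\ldots,g(t^k,p_k,p_{2k},\ldots),\ldots\bigr)$ (the $k$-th variable of $f$ being replaced by $g$ with $p_i\mapsto p_{ki}$, $t\mapsto t^k$). *)

theory Defs
  imports
    "HOL-Computational_Algebra.Formal_Power_Series"
    "HOL-Library.Multiset"
    "HOL-Library.FuncSet"
    "HOL-Library.Groups_Big_Fun"
    "HOL-Combinatorics.Permutations"
    "HOL-Combinatorics.Orbits"
begin

section \<open>Formal power series in \<open>p\<^sub>1, p\<^sub>2, \<dots>\<close>\<close>

text \<open>
  A monomial is a multiset of indices: \<open>{#1, 1, 3#}\<close> stands for \<open>p\<^sub>1\<^sup>2 p\<^sub>3\<close>.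
  The index \<open>0\<close> is available in the type, but does not occur in any cycle index series.
\<close>

typedef 'a pseries = "UNIV :: (nat multiset \<Rightarrow> 'a) set"
  morphisms pcoeff Abs_pseries ..

setup_lifting type_definition_pseries

lemma pseries_eqI: "(\<And>m. pcoeff f m = pcoeff g m) \<Longrightarrow> f = g"
  by transfer auto

lemma finite_msubsets: "finite {a. a \<subseteq># (m :: 'b multiset)}"
proof (induction m)
  case empty
  then show ?case by simp
next
  case (add x m)
  have "{a. a \<subseteq># add_mset x m} \<subseteq> {a. a \<subseteq># m} \<union> add_mset x ` {a. a \<subseteq># m}"
  proof
    fix a assume a: "a \<in> {a. a \<subseteq># add_mset x m}"
    show "a \<in> {a. a \<subseteq># m} \<union> add_mset x ` {a. a \<subseteq># m}"
    proof (cases "x \<in># a")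
      case True
      then obtain b where "a = add_mset x b" by (metis multi_member_split)
      then show ?thesis using a by auto
    next
      case False
      then show ?thesis using a
        by (metis UnI1 diff_empty diff_single_trivial mem_Collect_eq
            subset_eq_diff_conv add_mset_add_single)
    qed
  qed
  then show ?case using add.IH by (meson finite_UnI finite_imageI finite_subset)
qed

lemma finite_add_eq: "finite {(a, b). a + b = (m :: 'b multiset)}"
proof (rule finite_subset)
  show "{(a, b). a + b = m} \<subseteq> {a. a \<subseteq># m} \<times> {a. a \<subseteq># m}" by auto
qed (simp add: finite_msubsets)

instantiation pseries :: (comm_ring_1) comm_ring_1
begin

lift_definition zero_pseries :: "'a pseries" is "\<lambda>_. 0" .
lift_definition one_pseries :: "'a pseries" is "\<lambda>m. if m = {#} then 1 else 0" .
lift_definition plus_pseries :: "'a pseries \<Rightarrow> 'a pseries \<Rightarrow> 'a pseries"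
  is "\<lambda>f g m. f m + g m" .
lift_definition minus_pseries :: "'a pseries \<Rightarrow> 'a pseries \<Rightarrow> 'a pseries"
  is "\<lambda>f g m. f m - g m" .
lift_definition uminus_pseries :: "'a pseries \<Rightarrow> 'a pseries"
  is "\<lambda>f m. - f m" .
lift_definition times_pseries :: "'a pseries \<Rightarrow> 'a pseries \<Rightarrow> 'a pseries"
  is "\<lambda>f g m. \<Sum>(a, b) | a + b = m. f a * g b" .

instance
proof
  fix f g h :: "'a pseries"
  show "f + g + h = f + (g + h)" "f + g = g + f" "0 + f = f" "- f + f = 0" "f - g = f + - g"
    by (transfer; auto simp: algebra_simps)+
  show "(0 :: 'a pseries) \<noteq> 1"
    by transfer (metis zero_neq_one)
  show "f * g = g * f"
  proof (transfer, rule ext)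
    fix f g :: "nat multiset \<Rightarrow> 'a" and m
    show "(\<Sum>(a, b) | a + b = m. f a * g b) = (\<Sum>(a, b) | a + b = m. g a * f b)"
      by (rule sum.reindex_bij_witness[of _ prod.swap prod.swap])
         (auto simp: add.commute mult.commute)
  qed
  show "(f + g) * h = f * h + g * h"
    by transfer (auto simp: sum.distrib algebra_simps case_prod_unfold)
  show "1 * f = f"
  proof (transfer, rule ext)
    fix f :: "nat multiset \<Rightarrow> 'a" and m
    have "(\<Sum>(a, b) | a + b = m. (if a = {#} then 1 else 0) * f b)
        = (\<Sum>(a, b) \<in> {({#} :: nat multiset, m)}. (if a = {#} then 1 else 0) * f b)"
      by (rule sum.mono_neutral_right) (auto simp: finite_add_eq split: if_splits)
    then show "(\<Sum>(a, b) | a + b = m. (if a = {#} then 1 else 0) * f b) = f m"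
      by simp
  qed
  show "f * g * h = f * (g * h)"
  proof (transfer, rule ext)
    fix f g h :: "nat multiset \<Rightarrow> 'a" and m
    have "(\<Sum>(a, b) | a + b = m. (\<Sum>(c, d) | c + d = a. f c * g d) * h b)
        = (\<Sum>(p, q) \<in> Sigma {(a, b). a + b = m} (\<lambda>p. {(c, d). c + d = fst p}).
             f (fst q) * g (snd q) * h (snd p))"
      by (subst sum.Sigma[symmetric])
         (auto simp: finite_add_eq[unfolded case_prod_unfold] sum_distrib_right case_prod_unfold intro!: sum.cong)
    also have "\<dots> = (\<Sum>(p, q) \<in> Sigma {(a, b). a + b = m} (\<lambda>p. {(c, d). c + d = snd p}).
             f (fst p) * (g (fst q) * h (snd q)))"
      by (rule sum.reindex_bij_witness[of _
            "\<lambda>(p, q). ((fst p + fst q, snd q), (fst p, fst q))"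
            "\<lambda>(p, q). ((fst q, snd q + snd p), (snd q, snd p))"])
         (auto simp: algebra_simps)
    also have "\<dots> = (\<Sum>(a, b) | a + b = m. f a * (\<Sum>(c, d) | c + d = b. g c * h d))"
      by (subst sum.Sigma[symmetric])
         (auto simp: finite_add_eq[unfolded case_prod_unfold] sum_distrib_left case_prod_unfold intro!: sum.cong)
    finally show "(\<Sum>(a, b) | a + b = m. (\<Sum>(c, d) | c + d = a. f c * g d) * h b)
        = (\<Sum>(a, b) | a + b = m. f a * (\<Sum>(c, d) | c + d = b. g c * h d))" .
  qed
qed

end

lift_definition pmonom :: "'a::zero \<Rightarrow> nat multiset \<Rightarrow> 'a pseries"
  is "\<lambda>c m m'. if m' = m then c else 0" .

definition pconst :: "'a::zero \<Rightarrow> 'a pseries" where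
  "pconst c = pmonom c {#}"

definition pvar :: "nat \<Rightarrow> 'a::zero_neq_one pseries" where
  "pvar i = pmonom 1 {#i#}"

text \<open>
  Sum of a family of series in which every monomial has a nonzero coefficient in only finitely
  many members (\<^const>\<open>Sum_any\<close> is \<open>0\<close> on functions of infinite support).
\<close>

lift_definition formal_sum :: "('i \<Rightarrow> 'a pseries) \<Rightarrow> 'a::comm_monoid_add pseries"
  is "\<lambda>F m. Sum_any (\<lambda>i. F i m)" .

text \<open>
  \<open>f(G\<^sub>1, G\<^sub>2, \<dots>)\<close>.  The sum is locally finite if, for instance, each nonzero term of
  \<open>G\<^sub>k\<close> has degree at least \<open>k\<close>, where \<open>p\<^sub>i\<close> has degree \<open>i\<close>; in \<open>plethysm\<close> below this
  holds as soon as the inner series has no constant term.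
\<close>

definition psubst :: "'a::comm_ring_1 pseries \<Rightarrow> (nat \<Rightarrow> 'a pseries) \<Rightarrow> 'a pseries" where
  "psubst f G = formal_sum (\<lambda>m. pconst (pcoeff f m) * (\<Prod>k\<in>#m. G k))"

text \<open>
  The coefficient ring is \<open>\<rat>[[t]]\<close>, with \<open>t\<close> rendered as \<^const>\<open>fps_X\<close>.
  \<open>adams k g\<close> is \<open>g(t\<^sup>k, p\<^sub>k, p\<^sub>2\<^sub>k, \<dots>)\<close>.
\<close>

definition adams :: "nat \<Rightarrow> rat fps pseries \<Rightarrow> rat fps pseries" where
  "adams k g = formal_sum (\<lambda>m.
     pmonom (fps_compose (pcoeff g m) (fps_X ^ k)) (image_mset (\<lambda>i. k * i) m))"

definition plethysm :: "rat fps pseries \<Rightarrow> rat fps pseries \<Rightarrow> rat fps pseries"  (infixl "\<circ>\<^sub>p" 75) where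
  "f \<circ>\<^sub>p g = psubst f (\<lambda>k. adams k g)"


section \<open>Weighted species and cycle index series\<close>

text \<open>
  A species is given by its structures on finite sets of natural numbers, and by the relabelling
  of structures along permutations of the labels; nothing more enters its cycle index series.
\<close>

record 's weighted_species =
  structures :: "nat set \<Rightarrow> 's set"
  relabel :: "(nat \<Rightarrow> nat) \<Rightarrow> 's \<Rightarrow> 's"
  weight :: "'s \<Rightarrow> rat fps"

definition num_cycles :: "nat set \<Rightarrow> (nat \<Rightarrow> nat) \<Rightarrow> nat \<Rightarrow> nat" where
  "num_cycles A \<sigma> i = card {C \<in> orbit \<sigma> ` A. card C = i}"

definition cycle_index :: "'s weighted_species \<Rightarrow> rat fps pseries" where
  "cycle_index F = formal_sum (\<lambda>n.
     pconst (fps_const (1 / fact n)) *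
     (\<Sum>\<sigma> | \<sigma> permutes {1..n}.
        pconst (\<Sum>s | s \<in> structures F {1..n} \<and> relabel F \<sigma> s = s. weight F s) *
        (\<Prod>i=1..n. pvar i ^ num_cycles {1..n} \<sigma> i)))"


section \<open>Trees\<close>

text \<open>A simple graph is given by its set \<open>V\<close> of vertices and its set \<open>T\<close> of two-element edges.\<close>

definition simple_graph :: "'v set \<Rightarrow> 'v set set \<Rightarrow> bool" where
  "simple_graph V T \<longleftrightarrow> (\<forall>e\<in>T. e \<subseteq> V \<and> card e = 2)"

definition walk :: "'v set \<Rightarrow> 'v set set \<Rightarrow> 'v list \<Rightarrow> bool" where
  "walk V T xs \<longleftrightarrow> xs \<noteq> [] \<and> set xs \<subseteq> V \<and> successively (\<lambda>x y. {x, y} \<in> T) xs"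

definition graph_connected :: "'v set \<Rightarrow> 'v set set \<Rightarrow> bool" where
  "graph_connected V T \<longleftrightarrow> (\<forall>u\<in>V. \<forall>v\<in>V. \<exists>xs. walk V T xs \<and> hd xs = u \<and> last xs = v)"

definition graph_cycle :: "'v set \<Rightarrow> 'v set set \<Rightarrow> 'v list \<Rightarrow> bool" where
  "graph_cycle V T xs \<longleftrightarrow> walk V T xs \<and> distinct xs \<and> length xs \<ge> 3 \<and> {last xs, hd xs} \<in> T"

definition tree :: "'v set \<Rightarrow> 'v set set \<Rightarrow> bool" where
  "tree V T \<longleftrightarrow> V \<noteq> {} \<and> simple_graph V T \<and> graph_connected V T \<and> \<not> (\<exists>xs. graph_cycle V T xs)"

definition graph_dist :: "'v set \<Rightarrow> 'v set set \<Rightarrow> 'v \<Rightarrow> 'v \<Rightarrow> nat" where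
  "graph_dist V T u v = (LEAST n. \<exists>xs. walk V T xs \<and> hd xs = u \<and> last xs = v \<and> length xs = Suc n)"

text \<open>A rooted tree is the pair of its set of edges and its root.\<close>

type_synonym 'v rooted_tree = "'v set set \<times> 'v"

definition rooted_trees :: "'v set \<Rightarrow> 'v rooted_tree set" where
  "rooted_trees V = {(T, r). tree V T \<and> r \<in> V}"

definition relabel_rooted_tree :: "('v \<Rightarrow> 'w) \<Rightarrow> 'v rooted_tree \<Rightarrow> 'w rooted_tree" where
  "relabel_rooted_tree f = (\<lambda>(T, r). ((`) f ` T, f r))"

definition PreLie_species :: "nat rooted_tree weighted_species" where
  "PreLie_species =
     \<lparr>structures = rooted_trees, relabel = relabel_rooted_tree, weight = (\<lambda>_. 1)\<rparr>"

definition PreLie :: "rat fps pseries" where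
  "PreLie = cycle_index PreLie_species"


section \<open>Hollow hypertrees\<close>

definition hypergraph :: "'v set \<Rightarrow> 'v set set \<Rightarrow> bool" where
  "hypergraph V E \<longleftrightarrow> finite V \<and> (\<forall>e\<in>E. e \<subseteq> V \<and> card e \<ge> 2)"

definition incidences :: "'v set set \<Rightarrow> ('v + 'v set) set set" where
  "incidences E = {{Inl v, Inr e} | v e. e \<in> E \<and> v \<in> e}"

definition hypertree :: "'v set \<Rightarrow> 'v set set \<Rightarrow> bool" where
  "hypertree V E \<longleftrightarrow> hypergraph V E \<and> V \<noteq> {} \<and> tree (V <+> E) (incidences E)"

text \<open>The gap is \<^const>\<open>None\<close>, so that \<open>{#} \<squnion> I\<close> is \<open>with_gap I\<close>.\<close>

definition with_gap :: "'a set \<Rightarrow> 'a option set" where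
  "with_gap I = insert None (Some ` I)"

definition hollow_hypertree :: "'a set \<Rightarrow> 'a option set set \<Rightarrow> bool" where
  "hollow_hypertree I E \<longleftrightarrow> hypertree (with_gap I) E \<and> (\<exists>!e. e \<in> E \<and> None \<in> e)"

text \<open>
  Distances are taken in the incidence graph; between vertices they are twice the distances in
  the hypertree.  In a hypertree the nearest vertex is unique.
\<close>

definition petiole :: "'a set \<Rightarrow> 'a option set set \<Rightarrow> 'a option set \<Rightarrow> 'a option" where
  "petiole I E e =
     arg_min_on (\<lambda>v. graph_dist (with_gap I <+> E) (incidences E) (Inl None) (Inl v)) e"

text \<open>
  The decoration maps each edge to a rooted tree, and is \<^const>\<open>undefined\<close> outside the set of
  edges, so that a decorated hypertree is represented by one pair only.
\<close>

type_synonym 'a decorated_hypertree =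
  "'a option set set \<times> ('a option set \<Rightarrow> 'a option rooted_tree)"

definition hollow_PreLie_hypertrees :: "'a set \<Rightarrow> 'a decorated_hypertree set" where
  "hollow_PreLie_hypertrees I =
     {(E, D). hollow_hypertree I E \<and> D \<in> (\<Pi>\<^sub>E e\<in>E. rooted_trees (e - {petiole I E e}))}"

text \<open>
  Relabelling along a bijection \<open>\<sigma>\<close>, acting on vertices by fixing the gap: the edge \<open>e\<close> of the
  relabelled hypertree carries the relabelled decoration of the edge it comes from.
\<close>

definition relabel_decorated_hypertree ::
    "('a \<Rightarrow> 'b) \<Rightarrow> 'a decorated_hypertree \<Rightarrow> 'b decorated_hypertree" where
  "relabel_decorated_hypertree \<sigma> = (\<lambda>(E, D).
     let f = map_option \<sigma>; E' = (`) f ` E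
     in (E', \<lambda>e\<in>E'. relabel_rooted_tree f (D (f -` e))))"

definition hollow_PreLie_species :: "nat decorated_hypertree weighted_species" where
  "hollow_PreLie_species =
     \<lparr>structures = hollow_PreLie_hypertrees,
      relabel = relabel_decorated_hypertree,
      weight = (\<lambda>(E, D). fps_X ^ (card E - 1))\<rparr>"

end

theory Submission
  imports Defs
begin

text \<open>
  Deleting the gap and joining, for every other edge of the hypertree, its petiole to the root of
  its decoration turns a decorated hollow hypertree into a rooted tree in which the joining edges
  are marked; cutting the marked edges recovers the hypertree. This bijection is equivariant and
  the weight becomes \<open>t\<close> to the number of marked edges, that is, of marked non-root vertices.
  Summed over all subsets of vertices stable under \<open>\<sigma>\<close>, the weight is a product of factors
  \<open>1 + t\<^sup>k\<close>, one for each \<open>k\<close>-cycle of \<open>\<sigma>\<close>; as the root of a fixed tree is a fixed point, forbidding to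
  mark it divides the sum by \<open>1 + t\<close>.
\<close>

section \<open>Trees as parent functions\<close>

text \<open>Joining and cutting are never carried out on graphs. Both kinds of structure are read
  off one code, a pair of functions on \<open>I\<close>, by two maps \<open>hollow\<close> and
  \<open>rooted\<close> that are shown separately to be bijective and equivariant; the composite
  bijection is never written down. The obstacle is that trees are given by walks and cycles and
  petioles by distances, all awkward to carry through a cut. A parent function with a strictly
  decreasing rank avoids this: the rank yields reachability of the root, acyclicity and an induction
  principle at once, and ranks of pieces combine easily. The incidence graph is treated as a tree of
  the same kind, rooted at the gap, so that the petiole of an edge is simply its parent. The two
  sides are compared coefficientwise: replacing each \<open>p_k\<close> by
  \<open>(1 + t^k) p_k\<close> multiplies the coefficient at a monomial \<open>m\<close> by the
  product of \<open>1 + t^k\<close> over \<open>m\<close>, which is also what the stable subsets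
  give for every permutation of cycle type \<open>m\<close>.\<close>

definition parent_fun :: "'v set \<Rightarrow> 'v \<Rightarrow> ('v \<Rightarrow> 'v) \<Rightarrow> bool" where
  "parent_fun V r p \<longleftrightarrow> r \<in> V \<and> (\<forall>v\<in>V - {r}. p v \<in> V) \<and>
     (\<exists>h :: 'v \<Rightarrow> nat. \<forall>v\<in>V - {r}. h (p v) < h v)"

definition parent_edges :: "'v set \<Rightarrow> 'v \<Rightarrow> ('v \<Rightarrow> 'v) \<Rightarrow> 'v set set" where
  "parent_edges V r p = (\<lambda>v. {v, p v}) ` (V - {r})"

text \<open>
  Iterating a ranked map \<open>p\<close> from \<open>v\<close> eventually reaches any set containing the root; \<open>t v\<close> is the
  first element of that set which is met, and \<open>k v\<close> the time at which this happens.
\<close>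

lemma first_hit:
  fixes h :: "'v \<Rightarrow> nat"
  assumes p: "\<And>v. v \<in> V \<Longrightarrow> v \<notin> R \<Longrightarrow> p v \<in> V \<and> h (p v) < h v"
  obtains k t where "\<And>v. v \<in> V \<Longrightarrow> v \<in> R \<Longrightarrow> k v = (0::nat) \<and> t v = v"
    and "\<And>v. v \<in> V \<Longrightarrow> v \<notin> R \<Longrightarrow> k v = Suc (k (p v)) \<and> t v = t (p v)"
    and "\<And>v. v \<in> V \<Longrightarrow> t v \<in> V \<inter> R"
proof -
  have ex: "\<exists>k. (p ^^ k) v \<in> V \<inter> R" if "v \<in> V" for v
    using that
  proof (induction "h v" arbitrary: v rule: less_induct)
    case less
    show ?case
    proof (cases "v \<in> R")
      case True
      then show ?thesis using less.prems by (intro exI[of _ 0]) auto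
    next
      case False
      then obtain k where "(p ^^ k) (p v) \<in> V \<inter> R"
        using less p by blast
      then show ?thesis by (intro exI[of _ "Suc k"]) (simp add: funpow_swap1)
    qed
  qed
  define k where "k v = (LEAST k. (p ^^ k) v \<in> V \<inter> R)" for v
  show ?thesis
  proof (rule that[of k "\<lambda>v. (p ^^ k v) v"])
    fix v assume v: "v \<in> V"
    show "(p ^^ k v) v \<in> V \<inter> R"
      unfolding k_def by (rule LeastI_ex) (rule ex[OF v])
    show "k v = 0 \<and> (p ^^ k v) v = v" if "v \<in> R"
    proof -
      have "k v = 0" unfolding k_def using v that by (intro Least_equality) auto
      then show ?thesis by simp
    qed
    show "k v = Suc (k (p v)) \<and> (p ^^ k v) v = (p ^^ k (p v)) (p v)" if "v \<notin> R"
    proof -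
      obtain n where "(p ^^ n) v \<in> V \<inter> R" using ex[OF v] by blast
      then have "k v = Suc (LEAST m. (p ^^ Suc m) v \<in> V \<inter> R)"
        unfolding k_def using that by (intro Least_Suc) auto
      then have "k v = Suc (k (p v))" by (simp add: k_def funpow_swap1)
      then show ?thesis by (simp add: funpow_swap1)
    qed
  qed
qed

section \<open>Walks and distances\<close>

lemma walk_Cons:
  "walk V T (x # xs) \<longleftrightarrow> x \<in> V \<and> (xs = [] \<or> {x, hd xs} \<in> T \<and> walk V T xs)"
  by (cases xs) (auto simp: walk_def)

lemma walk_append:
  "xs \<noteq> [] \<Longrightarrow> ys \<noteq> [] \<Longrightarrow>
    walk V T (xs @ ys) \<longleftrightarrow> walk V T xs \<and> walk V T ys \<and> {last xs, hd ys} \<in> T"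
  by (auto simp: walk_def successively_append_iff)

lemma walk_rev: "walk V T (rev xs) \<longleftrightarrow> walk V T xs"
  by (simp add: walk_def insert_commute)

lemma walk_mono: "walk V T xs \<Longrightarrow> T \<subseteq> T' \<Longrightarrow> walk V T' xs"
  by (auto simp: walk_def intro: successively_mono)

lemma walk_join:
  assumes "walk V T xs" "walk V T ys" "last xs = hd ys"
  shows "\<exists>zs. walk V T zs \<and> hd zs = hd xs \<and> last zs = last ys"
proof (cases "tl ys")
  case Nil
  then have "ys = [hd ys]" using assms(2) by (cases ys) (auto simp: walk_def)
  then show ?thesis using assms by (metis last.simps)
next
  case (Cons a as)
  then have ys: "ys = hd ys # a # as" using assms(2) by (cases ys) (auto simp: walk_def)
  have "walk V T (hd ys # a # as)" using assms(2) ys by simp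
  then have "walk V T (xs @ a # as)"
    using assms by (subst walk_append) (auto simp: walk_Cons walk_def)
  moreover have "hd (xs @ a # as) = hd xs" using assms(1) by (auto simp: walk_def)
  moreover have "last (xs @ a # as) = last ys" by (subst ys) simp
  ultimately show ?thesis by blast
qed

text \<open>Cutting out the segment between two occurrences of a vertex shortens the walk and keeps
  its ends.\<close>

lemma ex_distinct_walk:
  assumes "walk V T xs"
  shows "\<exists>ys. walk V T ys \<and> hd ys = hd xs \<and> last ys = last xs \<and> distinct ys"
  using assms
proof (induction "length xs" arbitrary: xs rule: less_induct)
  case less
  show ?case
  proof (cases "distinct xs")
    case True
    then show ?thesis using less.prems by blast
  next
    case False
    then obtain a b c y where xs: "xs = a @ [y] @ b @ [y] @ c" using not_distinct_decomp by blast
    let ?zs = "a @ [y] @ c"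
    have "walk V T (a @ ((y # b) @ (y # c)))" using less.prems by (simp add: xs)
    then have w: "walk V T ((y # b) @ (y # c))" "a \<noteq> [] \<Longrightarrow> walk V T a \<and> {last a, y} \<in> T"
      by (cases "a = []"; simp add: walk_append del: append_Cons; simp)+
    have "walk V T (y # c)" using w(1) by (subst (asm) walk_append) auto
    with w(2) have "walk V T ?zs"
      by (cases "a = []") (auto simp: walk_append)
    moreover have "length ?zs < length xs" "hd ?zs = hd xs" "last ?zs = last xs"
      by (auto simp: xs hd_append)
    ultimately show ?thesis using less.hyps by metis
  qed
qed

text \<open>\<open>length\<close> counts vertices while \<open>graph_dist\<close> counts steps,
  hence the strict inequality and the \<open>Suc\<close>.\<close>

lemma graph_distI:
  assumes "walk V T xs" "hd xs = u" "last xs = v"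
  shows "graph_dist V T u v < length xs"
    and "\<exists>ys. walk V T ys \<and> hd ys = u \<and> last ys = v \<and> length ys = Suc (graph_dist V T u v)"
proof -
  have ex: "\<exists>ys. walk V T ys \<and> hd ys = u \<and> last ys = v \<and> length ys = Suc (length xs - 1)"
    using assms by (intro exI[of _ xs]) (auto simp: walk_def)
  have "graph_dist V T u v \<le> length xs - 1"
    unfolding graph_dist_def by (rule Least_le) (rule ex)
  then show "graph_dist V T u v < length xs" using assms(1) by (cases xs) (auto simp: walk_def)
  show "\<exists>ys. walk V T ys \<and> hd ys = u \<and> last ys = v \<and> length ys = Suc (graph_dist V T u v)"
    unfolding graph_dist_def by (rule LeastI_ex) (use ex in blast)
qed

text \<open>The rank in \<open>parent_fun\<close> may drop by any amount; the hitting time of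
  \<open>{r}\<close> is a rank that drops by exactly one.\<close>

lemma parent_fun_depth:
  assumes "parent_fun V r p"
  obtains d :: "'v \<Rightarrow> nat"
  where "d r = 0" "\<And>v. v \<in> V - {r} \<Longrightarrow> d v = Suc (d (p v))"
proof -
  obtain h :: "'v \<Rightarrow> nat" where h: "\<forall>v\<in>V - {r}. h (p v) < h v"
    using assms by (auto simp: parent_fun_def)
  show ?thesis
  proof (rule first_hit[of V "{r}" p h])
    show "v \<in> V \<Longrightarrow> v \<notin> {r} \<Longrightarrow> p v \<in> V \<and> h (p v) < h v" for v
      using assms h by (auto simp: parent_fun_def)
  qed (use that assms in \<open>auto simp: parent_fun_def\<close>)
qed

lemma walk_to_root:
  assumes "parent_fun V r p" "d r = (0::nat)" "\<And>v. v \<in> V - {r} \<Longrightarrow> d v = Suc (d (p v))" "v \<in> V"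
  shows "\<exists>xs. walk V (parent_edges V r p) xs \<and> hd xs = r \<and> last xs = v \<and> length xs = Suc (d v)"
  using assms(4)
proof (induction "d v" arbitrary: v)
  case 0
  then have "v = r" using assms(3)[of v] by fastforce
  then show ?case using 0 assms(2) by (intro exI[of _ "[r]"]) (auto simp: walk_def)
next
  case (Suc n)
  then have "v \<noteq> r" using assms(2) by auto
  then have v: "v \<in> V - {r}" using Suc by auto
  then have "p v \<in> V" using assms(1) by (auto simp: parent_fun_def)
  then obtain xs where xs: "walk V (parent_edges V r p) xs" "hd xs = r" "last xs = p v"
    "length xs = d v"
    using Suc assms(3)[OF v] by (metis nat.inject)
  have "{p v, v} \<in> parent_edges V r p" using v by (auto simp: parent_edges_def insert_commute)
  then show ?case
    using xs Suc.prems
    by (intro exI[of _ "xs @ [v]"]) (auto simp: walk_def successively_append_iff hd_append)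
qed

text \<open>Depth changes by one along every edge, so no walk from \<open>r\<close> reaches
  \<open>v\<close> in fewer than \<open>d v\<close> steps; climbing from \<open>v\<close> to the
  root attains this bound.\<close>

lemma graph_dist_parent_edges:
  assumes p: "parent_fun V r p" and d: "d r = (0::nat)" "\<And>v. v \<in> V - {r} \<Longrightarrow> d v = Suc (d (p v))"
    and v: "v \<in> V"
  shows "graph_dist V (parent_edges V r p) r v = d v"
proof -
  let ?T = "parent_edges V r p"
  have le: "d (last xs) < d (hd xs) + length xs" if "walk V ?T xs" for xs
    using that
  proof (induction xs)
    case Nil
    then show ?case by (simp add: walk_def)
  next
    case (Cons x xs)
    show ?case
    proof (cases "xs = []")
      case False
      then have xs: "{x, hd xs} \<in> ?T" "walk V ?T xs" using Cons.prems by (auto simp: walk_Cons)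
      then obtain w where "w \<in> V - {r}" "{x, hd xs} = {w, p w}" by (auto simp: parent_edges_def)
      then have "d (hd xs) \<le> Suc (d x)" using d(2) by (auto simp: doubleton_eq_iff)
      then show ?thesis using Cons.IH xs False by auto
    qed simp
  qed
  obtain xs where "walk V ?T xs \<and> hd xs = r \<and> last xs = v \<and> length xs = Suc (d v)"
    using walk_to_root[OF p d v] by blast
  then show ?thesis
    unfolding graph_dist_def
    by (intro Least_equality) (use le d in fastforce)+
qed

lemma graph_dist_parent:
  assumes "parent_fun V r p" "v \<in> V - {r}"
  shows "graph_dist V (parent_edges V r p) r v = Suc (graph_dist V (parent_edges V r p) r (p v))"
proof -
  obtain d :: "'a \<Rightarrow> nat" where d: "d r = 0" "\<And>v. v \<in> V - {r} \<Longrightarrow> d v = Suc (d (p v))"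
    using parent_fun_depth[OF assms(1)] by blast
  have "p v \<in> V" using assms by (auto simp: parent_fun_def)
  then show ?thesis
    using graph_dist_parent_edges[OF assms(1) d] d(2)[OF assms(2)] assms(2) by simp
qed

text \<open>The distance to \<open>r\<close> depends on the edge set only, and the parent is the end
  of an edge nearer to \<open>r\<close>, so the edge set fixes all orientations. Injectivity of both
  encodings rests on this.\<close>

lemma parent_edges_eqD:
  assumes p: "parent_fun V r p" and q: "parent_fun V r q"
    and eq: "parent_edges V r p = parent_edges V r q" and v: "v \<in> V - {r}"
  shows "p v = q v"
proof -
  let ?d = "graph_dist V (parent_edges V r p) r"
  have "{v, q v} \<in> parent_edges V r p" using v unfolding eq by (auto simp: parent_edges_def)
  then obtain w where w: "w \<in> V - {r}" "{v, q v} = {w, p w}" by (auto simp: parent_edges_def)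
  moreover have "?d v = Suc (?d (q v))"
    using graph_dist_parent[OF q v] by (simp add: eq)
  moreover have "?d w = Suc (?d (p w))" by (rule graph_dist_parent[OF p w(1)])
  ultimately show ?thesis by (auto simp: doubleton_eq_iff)
qed

lemma parent_edges_connected:
  assumes "parent_fun V r p"
  shows "graph_connected V (parent_edges V r p)"
  unfolding graph_connected_def
proof (intro ballI)
  fix u v assume uv: "u \<in> V" "v \<in> V"
  obtain d :: "'a \<Rightarrow> nat" where d: "d r = 0" "\<And>v. v \<in> V - {r} \<Longrightarrow> d v = Suc (d (p v))"
    using parent_fun_depth[OF assms] by blast
  obtain xs where xs: "walk V (parent_edges V r p) xs" "hd xs = r" "last xs = u"
    using walk_to_root[OF assms d uv(1)] by blast
  obtain ys where ys: "walk V (parent_edges V r p) ys" "hd ys = r" "last ys = v"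
    using walk_to_root[OF assms d uv(2)] by blast
  have "last (rev xs) = hd ys" "hd (rev xs) = u"
    using xs ys by (auto simp: last_rev hd_rev walk_def)
  then show "\<exists>xs. walk V (parent_edges V r p) xs \<and> hd xs = u \<and> last xs = v"
    using walk_join[of V _ "rev xs" ys] xs ys by (auto simp: walk_rev)
qed

lemma graph_cycle_nth:
  assumes "graph_cycle V T xs" "i < length xs"
  shows "{xs ! i, xs ! (Suc i mod length xs)} \<in> T"
proof (cases "Suc i = length xs")
  case True
  then show ?thesis
    using assms by (auto simp: graph_cycle_def last_conv_nth hd_conv_nth walk_def simp flip: True)
next
  case False
  then show ?thesis
    using assms by (auto simp: graph_cycle_def walk_def successively_conv_nth)
qed

text \<open>A vertex of maximal rank on a cycle would have two parents.\<close>

lemma parent_edges_acyclic: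
  assumes "parent_fun V r p"
  shows "\<not> graph_cycle V (parent_edges V r p) xs"
proof
  assume cyc: "graph_cycle V (parent_edges V r p) xs"
  obtain h :: "'a \<Rightarrow> nat" where h: "\<forall>v\<in>V - {r}. h (p v) < h v"
    using assms by (auto simp: parent_fun_def)
  have xs: "distinct xs" "length xs \<ge> 3" using cyc by (auto simp: graph_cycle_def)
  let ?n = "length xs"
  have "Max (h ` set xs) \<in> h ` set xs" using xs(2) by (intro Max_in) auto
  then obtain x where "x \<in> set xs" "h x = Max (h ` set xs)" by auto
  then have x: "x \<in> set xs" "\<And>y. y \<in> set xs \<Longrightarrow> h y \<le> h x" by auto
  obtain i where i: "i < ?n" "x = xs ! i" using x(1) by (metis in_set_conv_nth)
  \<comment> \<open>Position of the predecessor of \<open>x\<close> on the cycle, with wrap-around;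
    length at least 3 keeps it apart from the position of the successor.\<close>
  define j where "j = (if i = 0 then ?n - 1 else i - 1)"
  have j: "j < ?n" "Suc j mod ?n = i" using i xs by (auto simp: j_def)
  have i': "Suc i mod ?n < ?n" using i by (intro mod_less_divisor) auto
  have parent: "y = p x" if "{x, y} \<in> parent_edges V r p" "y \<in> set xs" for y
  proof -
    from that(1) obtain w where w: "{x, y} = {w, p w}" "w \<in> V - {r}"
      unfolding parent_edges_def by (rule imageE)
    then have "h (p w) < h w" using h by blast
    then show ?thesis using w(1) x(2)[OF that(2)] by (auto simp: doubleton_eq_iff)
  qed
  have "xs ! (Suc i mod ?n) = p x"
    using graph_cycle_nth[OF cyc i(1)] i' by (intro parent) (auto simp: i)
  moreover have "xs ! j = p x"
    using graph_cycle_nth[OF cyc j(1)] j i by (intro parent) (auto simp: insert_commute)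
  ultimately have "Suc i mod ?n = j"
    using xs(1) i' j(1) by (metis nth_eq_iff_index_eq)
  then show False using i xs(2) by (auto simp: j_def mod_Suc split: if_splits)
qed

lemma tree_parent_edges:
  assumes "parent_fun V r p"
  shows "tree V (parent_edges V r p)"
proof -
  obtain h :: "'a \<Rightarrow> nat" where h: "\<forall>v\<in>V - {r}. h (p v) < h v"
    using assms by (auto simp: parent_fun_def)
  have "v \<noteq> p v" if "v \<in> V - {r}" for v using h that by force
  then have "simple_graph V (parent_edges V r p)"
    using assms by (auto simp: simple_graph_def parent_edges_def parent_fun_def)
  then show ?thesis
    using assms parent_edges_connected[OF assms] parent_edges_acyclic[OF assms]
    by (auto simp: tree_def parent_fun_def)
qed

text \<open>
  Sending each vertex to a neighbour nearer to \<open>r\<close> yields a spanning tree; an edge outside of it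
  would close a cycle.
\<close>

lemma tree_imp_parent_fun:
  assumes "tree V T" "r \<in> V"
  obtains p where "parent_fun V r p" "T = parent_edges V r p"
proof -
  let ?d = "graph_dist V T r"
  have "\<exists>y\<in>V. {v, y} \<in> T \<and> ?d y < ?d v" if v: "v \<in> V - {r}" for v
  proof -
    obtain ys where "walk V T ys" "hd ys = r" "last ys = v"
      using assms v unfolding tree_def graph_connected_def by blast
    from graph_distI(2)[OF this] obtain xs where
      xs: "walk V T xs" "hd xs = r" "last xs = v" "length xs = Suc (?d v)" by blast
    \<comment> \<open>The last but one vertex of a shortest walk to \<open>v\<close> is the required
      neighbour: \<open>zs\<close> itself witnesses that it is nearer to \<open>r\<close>.\<close>
    define zs where "zs = butlast xs"
    have eq: "xs = zs @ [v]" using xs unfolding zs_def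
      by (metis append_butlast_last_id walk_def)
    have ne: "zs \<noteq> []" using eq xs v by auto
    then have z: "walk V T zs" "{last zs, v} \<in> T" "hd zs = r"
      using xs unfolding eq by (auto simp: walk_append)
    then have "?d (last zs) < length zs" by (intro graph_distI) auto
    also have "length zs = ?d v" using xs(4) eq by simp
    finally have "?d (last zs) < ?d v" .
    moreover have "last zs \<in> V" using z ne by (auto simp: walk_def)
    ultimately show ?thesis using z by (auto simp: insert_commute)
  qed
  then obtain p where p: "\<And>v. v \<in> V - {r} \<Longrightarrow> p v \<in> V \<and> {v, p v} \<in> T \<and> ?d (p v) < ?d v" by metis
  have par: "parent_fun V r p" using p assms(2) by (auto simp: parent_fun_def)
  have sub: "parent_edges V r p \<subseteq> T" using p by (auto simp: parent_edges_def)
  have "T \<subseteq> parent_edges V r p"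
  proof
    fix e assume e: "e \<in> T"
    then obtain x y where xy: "e = {x, y}" "x \<noteq> y" "x \<in> V" "y \<in> V"
      using assms by (auto simp: tree_def simple_graph_def card_2_iff dest!: bspec)
    show "e \<in> parent_edges V r p"
    proof (rule ccontr)
      assume ne: "e \<notin> parent_edges V r p"
      obtain zs where "walk V (parent_edges V r p) zs" "hd zs = x" "last zs = y"
        using parent_edges_connected[OF par] xy unfolding graph_connected_def by blast
      then obtain xs where xs: "walk V (parent_edges V r p) xs" "hd xs = x" "last xs = y" "distinct xs"
        using ex_distinct_walk by metis
      \<comment> \<open>Length 1 would force \<open>x = y\<close>, and length 2 would make
        \<open>e\<close> an edge of the spanning tree.\<close>
      have "length xs \<noteq> 0" "length xs \<noteq> 1" "length xs \<noteq> 2"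
        using xs xy ne by (auto simp: walk_def length_Suc_conv numeral_2_eq_2)
      then have "length xs \<ge> 3" by linarith
      then have "graph_cycle V T xs"
        using xs e walk_mono[OF xs(1) sub] by (auto simp: graph_cycle_def xy insert_commute)
      then show False using assms by (auto simp: tree_def)
    qed
  qed
  then show ?thesis using that par sub by blast
qed

section \<open>Hypertrees as parent functions\<close>

lemma Some_in_with_gap [simp]: "Some i \<in> with_gap I \<longleftrightarrow> i \<in> I"
  and None_in_with_gap [simp]: "None \<in> with_gap I"
  by (auto simp: with_gap_def)

text \<open>In the incidence tree rooted at the gap, \<open>e\<close> hangs below \<open>w\<close>
  and all other vertices of \<open>e\<close> hang below \<open>e\<close>. They are two steps farther
  away than \<open>w\<close>, so the minimum is strict and \<open>arg_min_on\<close> has no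
  choice.\<close>

lemma petiole_eqI:
  assumes par: "parent_fun (with_gap I <+> E) (Inl None) P"
    and inc: "incidences E = parent_edges (with_gap I <+> E) (Inl None) P"
    and e: "e \<in> E" "e \<subseteq> with_gap I" "w \<in> e" "P (Inr e) = Inl w"
    and v: "\<And>v. v \<in> e \<Longrightarrow> v \<noteq> w \<Longrightarrow> v \<noteq> None \<and> P (Inl v) = Inr e"
  shows "petiole I E e = w"
proof -
  define d where "d v = graph_dist (with_gap I <+> E) (incidences E) (Inl None) v" for v
  have d: "d v = Suc (d (P v))" if "v \<in> (with_gap I <+> E) - {Inl None}" for v
    using graph_dist_parent[OF par that] by (simp add: d_def inc)
  have less: "d (Inl w) < d (Inl v)" if "v \<in> e" "v \<noteq> w" for v
  proof -
    have "Inl v \<in> (with_gap I <+> E) - {Inl None}" using v[OF that] that e(2) by blast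
    moreover have "Inr e \<in> (with_gap I <+> E) - {Inl None}" using e(1) by auto
    ultimately show ?thesis using d[of "Inl v"] d[of "Inr e"] v[OF that] e(4) by simp
  qed
  define a where "a = petiole I E e"
  have "a \<in> e \<and> d (Inl a) \<le> d (Inl w)"
    unfolding a_def petiole_def arg_min_on_def d_def using e(3)
    by (auto intro: arg_min_natI arg_min_nat_le)
  then show ?thesis using less[of a] by (fastforce simp: a_def)
qed

text \<open>Rooting the incidence tree at the gap gives each vertex \<open>i\<close> a parent edge
  \<open>ed i\<close> and each edge its petiole as parent; an edge then consists of its petiole and
  its children. \<open>h\<close> is the rank of the incidence tree restricted to edges.\<close>

lemma hypertree_parents:
  assumes "hypertree (with_gap I) E"
  obtains ed :: "'a \<Rightarrow> 'a option set" and h :: "'a option set \<Rightarrow> nat"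
  where "\<And>i. i \<in> I \<Longrightarrow> ed i \<in> E"
    "\<And>e. e \<in> E \<Longrightarrow> petiole I E e \<in> with_gap I"
    "\<And>e. e \<in> E \<Longrightarrow> e = insert (petiole I E e) (Some ` {i \<in> I. ed i = e})"
    "\<And>e. e \<in> E \<Longrightarrow> petiole I E e \<notin> Some ` {i \<in> I. ed i = e}"
    "\<And>e i. e \<in> E \<Longrightarrow> petiole I E e = Some i \<Longrightarrow> h (ed i) < h e"
proof -
  let ?V = "with_gap I <+> E"
  have sub: "e \<subseteq> with_gap I" if "e \<in> E" for e
    using assms that by (auto simp: hypertree_def hypergraph_def)
  have "tree ?V (incidences E)" "Inl None \<in> ?V" using assms by (auto simp: hypertree_def)
  then obtain P where par: "parent_fun ?V (Inl None) P"
    and inc: "incidences E = parent_edges ?V (Inl None) P"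
    by (rule tree_imp_parent_fun)
  obtain h where h: "\<forall>v\<in>?V - {Inl None}. (h (P v) :: nat) < h v"
    using par by (auto simp: parent_fun_def)
  have Pin: "{x, P x} \<in> incidences E" if "x \<in> ?V - {Inl None}" for x
    using that by (auto simp: inc parent_edges_def)
  \<comment> \<open>The incidence graph is bipartite, so parents of vertices have the form
    \<open>Inr e\<close> and parents of edges the form \<open>Inl v\<close>; \<open>ed\<close> and
    \<open>pet\<close> strip the constructors.\<close>
  define ed where "ed i = (THE e. P (Inl (Some i)) = Inr e)" for i
  have ed: "ed i \<in> E \<and> P (Inl (Some i)) = Inr (ed i)" if "i \<in> I" for i
  proof -
    have "{Inl (Some i), P (Inl (Some i))} \<in> incidences E" using that by (intro Pin) auto
    then obtain v e where "{Inl (Some i), P (Inl (Some i))} = {Inl v, Inr e}" "e \<in> E"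
      by (auto simp: incidences_def)
    then show ?thesis by (auto simp: doubleton_eq_iff ed_def)
  qed
  define pet where "pet e = (THE v. P (Inr e) = Inl v)" for e
  have pet: "pet e \<in> e \<and> P (Inr e) = Inl (pet e)" if "e \<in> E" for e
  proof -
    have "{Inr e, P (Inr e)} \<in> incidences E" using that by (intro Pin) auto
    then obtain v e' where "{Inr e, P (Inr e)} = {Inl v, Inr e'}" "e' \<in> E" "v \<in> e'"
      by (auto simp: incidences_def)
    then show ?thesis by (auto simp: doubleton_eq_iff pet_def)
  qed
  have ed_in: "Some i \<in> ed i" if "i \<in> I" for i
  proof -
    have "{Inl (Some i), P (Inl (Some i))} \<in> incidences E" using that by (intro Pin) auto
    then show ?thesis using ed[OF that] by (auto simp: incidences_def doubleton_eq_iff)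
  qed
  \<comment> \<open>An incidence is an edge of the rooted tree, so one of its two ends is the parent
    of the other.\<close>
  have cases: "v = pet e \<or> (\<exists>i\<in>I. v = Some i \<and> ed i = e)" if "e \<in> E" "v \<in> e" for e v
  proof -
    have "{Inl v, Inr e} \<in> incidences E" using that by (auto simp: incidences_def)
    then obtain x where x: "x \<in> ?V - {Inl None}" "{Inl v, Inr e} = {x, P x}"
      by (auto simp: inc parent_edges_def)
    then show ?thesis
    proof (cases x)
      case (Inl w)
      then obtain i where "w = Some i" "i \<in> I" using x(1) by (cases w) auto
      then show ?thesis using ed[of i] x(2) Inl by (auto simp: doubleton_eq_iff)
    next
      case (Inr e')
      then show ?thesis using pet[OF that(1)] x(2) by (auto simp: doubleton_eq_iff)
    qed
  qed
  have less: "h (Inl (pet e)) < h (Inr e)" if "e \<in> E" for e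
    using h pet[OF that] that by (metis DiffI InrI Inl_Inr_False singletonD)
  have less': "h (Inr (ed i)) < h (Inl (Some i))" if "i \<in> I" for i
  proof -
    have "Inl (Some i) \<in> ?V - {Inl None}" using that by auto
    then have "h (P (Inl (Some i))) < h (Inl (Some i))" using h by blast
    then show ?thesis using ed[OF that] by simp
  qed
  have petiole: "petiole I E e = pet e" if "e \<in> E" for e
    using par inc that sub[OF that] conjunct1[OF pet[OF that]] conjunct2[OF pet[OF that]]
  proof (rule petiole_eqI)
    fix v assume "v \<in> e" "v \<noteq> pet e"
    then show "v \<noteq> None \<and> P (Inl v) = Inr e" using cases[OF that] ed by auto
  qed
  show ?thesis
  proof (rule that[of ed "\<lambda>e. h (Inr e)"])
    show "ed i \<in> E" if "i \<in> I" for i using ed that by blast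
    fix e assume e: "e \<in> E"
    show "petiole I E e \<in> with_gap I" using petiole pet sub e by auto
    show "e = insert (petiole I E e) (Some ` {i \<in> I. ed i = e})"
      using petiole[OF e] pet[OF e] cases[OF e] ed_in by auto
    show "petiole I E e \<notin> Some ` {i \<in> I. ed i = e}"
      using petiole[OF e] less[OF e] less' by fastforce
    show "h (Inr (ed i)) < h (Inr e)" if "petiole I E e = Some i" for i
    proof -
      have "i \<in> I" using petiole[OF e] that pet[OF e] sub[OF e] Some_in_with_gap by (metis subsetD)
      then show ?thesis using petiole[OF e] less[OF e] that less'[of i] by simp
    qed
  qed
qed

section \<open>Rooted trees with a set of cut edges\<close>

text \<open>
  A pair \<open>(p, t)\<close> encodes a rooted tree on \<open>I\<close> together with a set of its edges: \<open>p\<close> is the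
  parent function, the parent of the root being the gap, and after removal of the chosen edges
  \<open>t i\<close> is the root of the component of \<open>i\<close>.
\<close>

locale cut_tree =
  fixes I :: "'a set" and p :: "'a \<Rightarrow> 'a option" and t :: "'a \<Rightarrow> 'a"
  assumes finite_I: "finite I"
    and p_funcset: "p \<in> I \<rightarrow>\<^sub>E with_gap I"
    and t_funcset: "t \<in> I \<rightarrow>\<^sub>E I"
    and ex1_root: "\<exists>!r. r \<in> I \<and> p r = None"
    and ex_rank: "\<exists>h :: 'a \<Rightarrow> nat. \<forall>i\<in>I. \<forall>j. p i = Some j \<longrightarrow> h j < h i"
    and t_cases: "i \<in> I \<Longrightarrow> t i = i \<or> (\<exists>j. p i = Some j \<and> t i = t j)"
begin

section \<open>Hypertree and marked rooted tree of a cut tree\<close>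

definition root :: 'a where "root = (THE r. r \<in> I \<and> p r = None)"

text \<open>The roots of the components: the root of the whole tree and the lower ends of the cut
  edges.\<close>

definition tops :: "'a set" where "tops = {u \<in> I. t u = u}"

definition block :: "'a \<Rightarrow> 'a set" where "block u = {v \<in> I. t v = u}"

text \<open>The component below \<open>u\<close> with the upper end of its cut edge added; this
  added vertex will be the petiole, the gap if \<open>u\<close> is the root.\<close>

definition edge :: "'a \<Rightarrow> 'a option set" where "edge u = insert (p u) (Some ` block u)"

definition deco :: "'a \<Rightarrow> 'a option rooted_tree" where
  "deco u = (parent_edges (Some ` block u) (Some u) (p \<circ> the), Some u)"

text \<open>Decorations are indexed by edges and not by component roots; \<open>the_inv_into\<close>
  translates, legitimately by \<open>inj_edge\<close>.\<close>

definition hollow :: "'a decorated_hypertree" where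
  "hollow = (edge ` tops, \<lambda>e\<in>edge ` tops. deco (the_inv_into tops edge e))"

text \<open>The mark of a cut edge is stored at its lower end. \<open>the \<circ> p\<close> is
  unspecified at \<open>root\<close>, where \<open>parent_edges\<close> does not evaluate
  it.\<close>

definition rooted :: "'a rooted_tree \<times> 'a set" where
  "rooted = ((parent_edges I root (the \<circ> p), root), tops - {root})"

lemma p_Some: "i \<in> I \<Longrightarrow> p i = Some j \<Longrightarrow> j \<in> I"
  using p_funcset by (metis PiE_mem Some_in_with_gap)

lemma t_in: "i \<in> I \<Longrightarrow> t i \<in> I"
  using t_funcset by auto

lemma root: "root \<in> I" "p root = None" "i \<in> I \<Longrightarrow> p i = None \<Longrightarrow> i = root"
proof -
  have "root \<in> I \<and> p root = None" unfolding root_def by (rule theI') (rule ex1_root)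
  then show "root \<in> I" "p root = None" "i \<in> I \<Longrightarrow> p i = None \<Longrightarrow> i = root"
    using ex1_root by auto
qed

lemma root_in_tops: "root \<in> tops"
  using t_cases[of root] root(1,2) by (auto simp: tops_def)

text \<open>Climbing to the parent as long as \<open>t i\<close> differs from \<open>i\<close>
  preserves \<open>t i\<close> and lowers the rank. The rank bound is what keeps petioles out of
  their own components.\<close>

lemma top_props:
  assumes "i \<in> I" and h: "\<forall>i\<in>I. \<forall>j. p i = Some j \<longrightarrow> h j < (h i :: nat)"
  shows "t i \<in> tops \<and> h (t i) \<le> h i"
  using assms(1)
proof (induction "h i" arbitrary: i rule: less_induct)
  case less
  show ?case
  proof (cases "t i = i")
    case True
    then show ?thesis using less.prems by (simp add: tops_def)
  next
    case False
    then obtain j where j: "p i = Some j" "t i = t j" using t_cases less.prems by blast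
    then show ?thesis using less.hyps[of j] less.prems h p_Some by fastforce
  qed
qed

lemma t_in_tops: "i \<in> I \<Longrightarrow> t i \<in> tops"
  using ex_rank top_props by blast

lemma tops_subset: "tops \<subseteq> I"
  by (auto simp: tops_def)

lemma in_block: "u \<in> tops \<Longrightarrow> u \<in> block u"
  by (auto simp: tops_def block_def)

lemma p_in_block: "v \<in> block u \<Longrightarrow> v \<noteq> u \<Longrightarrow> p v \<in> Some ` block u"
  using t_cases[of v] p_Some by (auto simp: block_def)

text \<open>No member of a component ranks below the component root \<open>u\<close>, but the parent
  of \<open>u\<close> does.\<close>

lemma p_notin_block: "u \<in> tops \<Longrightarrow> p u \<notin> Some ` block u"
proof
  assume u: "u \<in> tops" and "p u \<in> Some ` block u"
  then obtain w where w: "p u = Some w" "w \<in> I" "t w = u" by (auto simp: block_def)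
  obtain h :: "'a \<Rightarrow> nat" where h: "\<forall>i\<in>I. \<forall>j. p i = Some j \<longrightarrow> h j < h i" using ex_rank by blast
  have "h u \<le> h w" using top_props[OF w(2) h] w by simp
  then show False using h u tops_subset w by fastforce
qed

lemma edge_diff: "u \<in> tops \<Longrightarrow> edge u - {p u} = Some ` block u"
  using p_notin_block by (auto simp: edge_def)

text \<open>If two component roots gave the same edge, neither would lie in the block of the other,
  so each would be the parent of the other, against the rank.\<close>

lemma inj_edge: "inj_on edge tops"
proof (rule inj_onI, rule ccontr)
  fix u w assume uw: "u \<in> tops" "w \<in> tops" "edge u = edge w" "u \<noteq> w"
  obtain h :: "'a \<Rightarrow> nat" where h: "\<forall>i\<in>I. \<forall>j. p i = Some j \<longrightarrow> h j < h i" using ex_rank by blast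
  have "Some u \<in> edge w" "Some w \<in> edge u" using uw in_block by (auto simp: edge_def)
  then have "p w = Some u" "p u = Some w" using uw by (auto simp: edge_def block_def tops_def)
  then have "h u < h w" "h w < h u" using h uw tops_subset by blast+
  then show False by simp
qed

lemma hollow_apply: "u \<in> tops \<Longrightarrow> snd hollow (edge u) = deco u"
  by (simp add: hollow_def the_inv_into_f_f[OF inj_edge])

lemma deco_parent_fun: "u \<in> tops \<Longrightarrow> parent_fun (Some ` block u) (Some u) (p \<circ> the)"
proof -
  assume u: "u \<in> tops"
  obtain h :: "'a \<Rightarrow> nat" where h: "\<forall>i\<in>I. \<forall>j. p i = Some j \<longrightarrow> h j < h i" using ex_rank by blast
  show ?thesis unfolding parent_fun_def
  proof (intro conjI ballI exI[of _ "h \<circ> the"])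
    show "Some u \<in> Some ` block u" using u in_block by blast
    fix v assume v: "v \<in> Some ` block u - {Some u}"
    then obtain i where i: "v = Some i" "i \<in> block u" "i \<noteq> u" by auto
    then obtain j where j: "p i = Some j" "j \<in> block u" using p_in_block by blast
    then show "(p \<circ> the) v \<in> Some ` block u" by (simp add: i)
    show "(h \<circ> the) ((p \<circ> the) v) < (h \<circ> the) v" using h i j by (auto simp: block_def)
  qed
qed

text \<open>An explicit parent function for the incidence graph, with vertices below the edge of
  their component and edges below their petiole. It yields both that the graph is a tree and,
  through \<open>petiole_eqI\<close>, what the petioles are.\<close>

lemma incidence_tree:
  defines "E \<equiv> edge ` tops"
  defines "P \<equiv> case_sum (\<lambda>v. Inr (edge (t (the v)))) (\<lambda>e. Inl (p (the_inv_into tops edge e)))"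
  shows "parent_fun (with_gap I <+> E) (Inl None) P"
    and "incidences E = parent_edges (with_gap I <+> E) (Inl None) P"
proof -
  have P: "P (Inl (Some i)) = Inr (edge (t i))" "u \<in> tops \<Longrightarrow> P (Inr (edge u)) = Inl (p u)" for i u
    by (simp_all add: P_def the_inv_into_f_f[OF inj_edge])
  obtain h :: "'a \<Rightarrow> nat" where h: "\<forall>i\<in>I. \<forall>j. p i = Some j \<longrightarrow> h j < h i" using ex_rank by blast
  \<comment> \<open>Doubling leaves an odd value for each edge, just below that of its top and above
    that of its petiole: \<open>h (t i) \<le> h i\<close> gives
    \<open>2 * h (t i) + 1 < 2 * h i + 2\<close>, and \<open>h j < h u\<close> gives
    \<open>2 * h j + 2 < 2 * h u + 1\<close>.\<close>
  define H where "H = case_sum (\<lambda>v. case v of None \<Rightarrow> 0 | Some i \<Rightarrow> 2 * h i + 2)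
     (\<lambda>e. 2 * h (the_inv_into tops edge e) + 1)"
  have H: "H (Inl None) = 0" "H (Inl (Some i)) = 2 * h i + 2"
    "u \<in> tops \<Longrightarrow> H (Inr (edge u)) = 2 * h u + 1" for i u
    by (simp_all add: H_def the_inv_into_f_f[OF inj_edge])
  have V: "(with_gap I <+> E) - {Inl None} = (Inl \<circ> Some) ` I \<union> (Inr \<circ> edge) ` tops"
    by (auto simp: with_gap_def E_def)
  show "parent_fun (with_gap I <+> E) (Inl None) P"
    unfolding parent_fun_def V
  proof (intro conjI exI[of _ H] ballI)
    fix v assume "v \<in> (Inl \<circ> Some) ` I \<union> (Inr \<circ> edge) ` tops"
    then consider i where "i \<in> I" "v = Inl (Some i)" | u where "u \<in> tops" "v = Inr (edge u)" by auto
    then have "P v \<in> with_gap I <+> E \<and> H (P v) < H v"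
    proof cases
      case 1
      then show ?thesis using t_in_tops[of i] top_props[OF 1(1) h] by (auto simp: P H E_def)
    next
      case 2
      then show ?thesis using h tops_subset p_Some
        by (cases "p u") (fastforce simp: P H)+
    qed
    then show "P v \<in> with_gap I <+> E" "H (P v) < H v" by auto
  qed auto
  show "incidences E = parent_edges (with_gap I <+> E) (Inl None) P"
  proof
    show "incidences E \<subseteq> parent_edges (with_gap I <+> E) (Inl None) P"
    proof
      fix x assume "x \<in> incidences E"
      then obtain v u where x: "x = {Inl v, Inr (edge u)}" "u \<in> tops" "v \<in> edge u"
        by (auto simp: incidences_def E_def)
      then consider "v = p u" | i where "i \<in> I" "v = Some i" "t i = u"
        by (auto simp: edge_def block_def)
      then show "x \<in> parent_edges (with_gap I <+> E) (Inl None) P"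
      proof cases
        case 1
        then have "x = {Inr (edge u), P (Inr (edge u))}" using x P by auto
        then show ?thesis using x(2) by (auto simp: parent_edges_def V)
      next
        case 2
        then have "x = {Inl (Some i), P (Inl (Some i))}" using x P by auto
        then show ?thesis using 2 by (auto simp: parent_edges_def V)
      qed
    qed
    show "parent_edges (with_gap I <+> E) (Inl None) P \<subseteq> incidences E"
    proof
      fix x assume "x \<in> parent_edges (with_gap I <+> E) (Inl None) P"
      then consider i where "i \<in> I" "x = {Inl (Some i), P (Inl (Some i))}"
        | u where "u \<in> tops" "x = {Inr (edge u), P (Inr (edge u))}"
        unfolding parent_edges_def V by auto
      then show "x \<in> incidences E"
      proof cases
        case 1
        then have "x = {Inl (Some i), Inr (edge (t i))}" "Some i \<in> edge (t i)"
          by (auto simp: P edge_def block_def)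
        then show ?thesis using t_in_tops[OF 1(1)] unfolding incidences_def E_def by blast
      next
        case 2
        then have "x = {Inl (p u), Inr (edge u)}" using P(2) by (simp add: insert_commute)
        moreover have "p u \<in> edge u" by (simp add: edge_def)
        ultimately show ?thesis using 2(1) unfolding incidences_def E_def by blast
      qed
    qed
  qed
qed

lemma edge_subset: "u \<in> tops \<Longrightarrow> edge u \<subseteq> with_gap I"
  using p_funcset by (auto simp: edge_def block_def tops_def)

lemma petiole_edge:
  assumes "u \<in> tops"
  shows "petiole I (edge ` tops) (edge u) = p u"
proof (rule petiole_eqI[OF incidence_tree])
  show "edge u \<in> edge ` tops" "edge u \<subseteq> with_gap I" "p u \<in> edge u"
    using assms edge_subset by (auto simp: edge_def)
  show "case_sum (\<lambda>v. Inr (edge (t (the v)))) (\<lambda>e. Inl (p (the_inv_into tops edge e))) (Inr (edge u))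
      = Inl (p u)"
    using assms by (simp add: the_inv_into_f_f[OF inj_edge])
qed (use assms in \<open>auto simp: edge_def block_def\<close>)

lemma hollow_in: "hollow \<in> hollow_PreLie_hypertrees I"
proof -
  have "hypergraph (with_gap I) (edge ` tops)"
    unfolding hypergraph_def
  proof (intro conjI ballI)
    show "finite (with_gap I)" using finite_I by (simp add: with_gap_def)
    fix e assume "e \<in> edge ` tops"
    then obtain u where u: "u \<in> tops" "e = edge u" by auto
    then show "e \<subseteq> with_gap I" using edge_subset by simp
    have "finite (block u)" using finite_I by (simp add: block_def)
    then have "card e = Suc (card (block u))"
      using u p_notin_block by (simp add: edge_def card_insert_if card_image)
    moreover have "card (block u) \<noteq> 0"
      using in_block[OF u(1)] \<open>finite (block u)\<close> by auto
    ultimately show "2 \<le> card e" by linarith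
  qed
  moreover have "tree (with_gap I <+> edge ` tops) (incidences (edge ` tops))"
    using tree_parent_edges[OF incidence_tree(1)] incidence_tree(2) by simp
  ultimately have "hypertree (with_gap I) (edge ` tops)"
    by (auto simp: hypertree_def with_gap_def)
  moreover have "\<exists>!e. e \<in> edge ` tops \<and> None \<in> e"
  proof (rule ex1I[of _ "edge root"])
    show "edge root \<in> edge ` tops \<and> None \<in> edge root"
      using root(2) root_in_tops by (intro conjI imageI) (auto simp: edge_def)
    fix e assume "e \<in> edge ` tops \<and> None \<in> e"
    then obtain u where "u \<in> tops" "e = edge u" "p u = None" by (auto simp: edge_def)
    then show "e = edge root" using root(3)[of u] tops_subset by auto
  qed
  moreover have "deco u \<in> rooted_trees (edge u - {petiole I (edge ` tops) (edge u)})"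
    if "u \<in> tops" for u
    using tree_parent_edges[OF deco_parent_fun[OF that]] in_block[OF that]
    by (auto simp: petiole_edge[OF that] edge_diff[OF that] deco_def rooted_trees_def)
  then have "snd hollow \<in> (\<Pi>\<^sub>E e\<in>edge ` tops. rooted_trees (e - {petiole I (edge ` tops) e}))"
    using hollow_apply by (intro PiE_I) (auto simp: hollow_def)
  ultimately show ?thesis
    by (auto simp: hollow_PreLie_hypertrees_def hollow_hypertree_def hollow_def)
qed

lemma rooted_parent_fun: "parent_fun I root (the \<circ> p)"
proof -
  obtain h :: "'a \<Rightarrow> nat" where h: "\<forall>i\<in>I. \<forall>j. p i = Some j \<longrightarrow> h j < h i" using ex_rank by blast
  have "\<exists>j. p i = Some j \<and> j \<in> I" if "i \<in> I - {root}" for i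
    using that root(3)[of i] p_Some[of i] by (cases "p i") auto
  then show ?thesis using h root(1) by (fastforce simp: parent_fun_def intro!: exI[of _ h])
qed

lemma rooted_in: "rooted \<in> Sigma (rooted_trees I) (\<lambda>(T, r). Pow (I - {r}))"
  using tree_parent_edges[OF rooted_parent_fun] root(1) tops_subset
  by (auto simp: rooted_def rooted_trees_def)

text \<open>Edges correspond to component roots; the edge discounted by the weight is the one at the
  gap, which belongs to \<open>root\<close>, the vertex that cannot be marked.\<close>

lemma card_hollow: "card (fst hollow) - 1 = card (snd rooted)"
proof -
  have "finite tops" using finite_I tops_subset by (rule finite_subset[rotated])
  then show ?thesis
    using root_in_tops by (simp add: hollow_def rooted_def card_image[OF inj_edge])
qed

end

section \<open>Both encodings are bijections\<close>

definition cut_trees :: "'a set \<Rightarrow> (('a \<Rightarrow> 'a option) \<times> ('a \<Rightarrow> 'a)) set" where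
  "cut_trees I = {(p, t). cut_tree I p t}"

text \<open>The data come back in turn: the roots of the decorations are the tops, the petioles give
  \<open>p\<close> on the tops, the edges without petioles are the blocks and give \<open>t\<close>,
  and the decorations give \<open>p\<close> inside the blocks.\<close>

lemma hollow_inject:
  assumes "cut_tree I p t" "cut_tree I p' t'" "cut_tree.hollow I p t = cut_tree.hollow I p' t'"
  shows "p = p' \<and> t = t'"
proof -
  interpret A: cut_tree I p t by fact
  interpret B: cut_tree I p' t' by fact
  have "Some ` A.tops = (\<lambda>e. snd (snd A.hollow e)) ` fst A.hollow"
    by (simp add: A.hollow_def image_image A.deco_def the_inv_into_f_f[OF A.inj_edge])
  moreover have "Some ` B.tops = (\<lambda>e. snd (snd B.hollow e)) ` fst B.hollow"
    by (simp add: B.hollow_def image_image B.deco_def the_inv_into_f_f[OF B.inj_edge])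
  ultimately have "Some ` A.tops = Some ` B.tops" using assms(3) by simp
  then have tops: "A.tops = B.tops" by (simp add: inj_image_eq_iff)
  have E: "A.edge ` A.tops = B.edge ` B.tops" using assms(3) by (simp add: A.hollow_def B.hollow_def)
  have edge: "A.edge u = B.edge u" and deco: "A.deco u = B.deco u" if u: "u \<in> A.tops" for u
  proof -
    have "A.edge u \<in> B.edge ` B.tops" using u unfolding E[symmetric] by (rule imageI)
    then obtain w where w: "w \<in> B.tops" "A.edge u = B.edge w" by (rule imageE) blast
    then have "A.deco u = B.deco w"
      using A.hollow_apply[OF u] B.hollow_apply[OF w(1)] assms(3) by simp
    moreover from this have "u = w" by (simp add: A.deco_def B.deco_def)
    ultimately show "A.edge u = B.edge u" "A.deco u = B.deco u" using w by auto
  qed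
  have top: "p u = p' u" if u: "u \<in> A.tops" for u
    using A.petiole_edge[OF u] B.petiole_edge[of u] u edge[OF u] E tops by simp
  have block: "A.block u = B.block u" if u: "u \<in> A.tops" for u
  proof -
    have "Some ` A.block u = Some ` B.block u"
      using A.edge_diff[OF u] B.edge_diff[of u] u edge[OF u] top[OF u] tops by simp
    then show ?thesis by (simp add: inj_image_eq_iff)
  qed
  have t: "t i = t' i" if "i \<in> I" for i
  proof -
    have "i \<in> A.block (t i)" using that by (simp add: A.block_def)
    then have "i \<in> B.block (t i)" using block A.t_in_tops[OF that] by simp
    then show ?thesis by (simp add: B.block_def)
  qed
  have p: "p i = p' i" if i: "i \<in> I" for i
  proof (cases "i \<in> A.tops")
    case False
    define u where "u = t i"
    have u: "u \<in> A.tops" "i \<in> A.block u" using A.t_in_tops[OF i] i by (simp_all add: u_def A.block_def)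
    have "parent_edges (Some ` A.block u) (Some u) (p \<circ> the)
        = parent_edges (Some ` A.block u) (Some u) (p' \<circ> the)"
      using deco[OF u(1)] block[OF u(1)] by (simp add: A.deco_def B.deco_def)
    moreover have "parent_fun (Some ` A.block u) (Some u) (p' \<circ> the)"
      using B.deco_parent_fun[of u] u tops block[OF u(1)] by simp
    moreover have "Some i \<in> Some ` A.block u - {Some u}" using u False by auto
    ultimately have "(p \<circ> the) (Some i) = (p' \<circ> the) (Some i)"
      by (intro parent_edges_eqD[OF A.deco_parent_fun[OF u(1)]])
    then show ?thesis by simp
  qed (rule top)
  show ?thesis
    using PiE_ext[OF A.p_funcset B.p_funcset] PiE_ext[OF A.t_funcset B.t_funcset] p t by blast
qed

lemma parent_edges_cong:
  "(\<And>v. v \<in> V - {r} \<Longrightarrow> p v = q v) \<Longrightarrow> parent_edges V r p = parent_edges V r q"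
  by (auto simp: parent_edges_def)

text \<open>
  The rank of the parent function compares first the ranks of the edges in the hypertree, and
  then the ranks of the vertices within the decoration of an edge.
\<close>

lemma hollow_surj:
  assumes "(E, D) \<in> hollow_PreLie_hypertrees I"
  shows "\<exists>p t. cut_tree I p t \<and> cut_tree.hollow I p t = (E, D)"
proof -
  define pet where "pet = petiole I E"
  have ht: "hypertree (with_gap I) E" and ex1: "\<exists>!e. e \<in> E \<and> None \<in> e"
    and D: "D \<in> (\<Pi>\<^sub>E e\<in>E. rooted_trees (e - {pet e}))"
    using assms by (auto simp: hollow_PreLie_hypertrees_def hollow_hypertree_def pet_def)
  have fin: "finite I"
    using ht by (auto simp: hypertree_def hypergraph_def with_gap_def dest: finite_imageD)
  show ?thesis
  proof (rule hypertree_parents[OF ht, folded pet_def])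
    fix ed and h :: "'a option set \<Rightarrow> nat"
    assume ed: "\<And>i. i \<in> I \<Longrightarrow> ed i \<in> E"
      and pet: "\<And>e. e \<in> E \<Longrightarrow> pet e \<in> with_gap I"
      and edge: "\<And>e. e \<in> E \<Longrightarrow> e = insert (pet e) (Some ` {i \<in> I. ed i = e})"
      and notin: "\<And>e. e \<in> E \<Longrightarrow> pet e \<notin> Some ` {i \<in> I. ed i = e}"
      and h: "\<And>e i. e \<in> E \<Longrightarrow> pet e = Some i \<Longrightarrow> h (ed i) < h e"
    define W where "W e = Some ` {i \<in> I. ed i = e}" for e
    have edge_iff: "v \<in> e \<longleftrightarrow> v = pet e \<or> (\<exists>i\<in>I. v = Some i \<and> ed i = e)" if "e \<in> E" for e v
      using arg_cong[OF edge[OF that], of "\<lambda>s. v \<in> s"] by blast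
    have W: "e - {pet e} = W e" if "e \<in> E" for e
      using edge_iff[OF that] notin[OF that] unfolding W_def by blast
    \<comment> \<open>All properties of the root, parent function and rank chosen for one edge are
      bundled, so that one choice over \<open>E\<close> provides them together.\<close>
    define deco_props where "deco_props e r q g \<longleftrightarrow>
        snd (D e) = Some r \<and> r \<in> I \<and> ed r = e \<and> (\<forall>v\<in>W e - {Some r}. q v \<in> W e) \<and>
        fst (D e) = parent_edges (W e) (Some r) q \<and> (\<forall>v\<in>W e - {Some r}. (g (q v) :: nat) < g v)"
      for e r q g
    have "\<exists>r q g. deco_props e r q g" if "e \<in> E" for e
    proof -
      have "D e \<in> rooted_trees (W e)" using D that W[OF that] by (metis PiE_mem)
      then have Dt: "tree (W e) (fst (D e))" "snd (D e) \<in> W e" by (auto simp: rooted_trees_def)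
      from Dt(2) obtain r where r: "snd (D e) = Some r" "r \<in> I" "ed r = e" by (auto simp: W_def)
      obtain q where q: "parent_fun (W e) (Some r) q" "fst (D e) = parent_edges (W e) (Some r) q"
        using tree_imp_parent_fun[OF Dt] unfolding r(1) by blast
      from q(1) obtain g where "\<forall>v\<in>W e - {Some r}. (g (q v) :: nat) < g v" by (auto simp: parent_fun_def)
      moreover have "\<forall>v\<in>W e - {Some r}. q v \<in> W e" using q(1) by (simp add: parent_fun_def)
      ultimately show ?thesis using r q(2) unfolding deco_props_def by blast
    qed
    then obtain rt q g where choice: "\<And>e. e \<in> E \<Longrightarrow> deco_props e (rt e) (q e) (g e)" by metis
    have rt: "snd (D e) = Some (rt e)" "rt e \<in> I" "ed (rt e) = e"
      and q: "v \<in> W e - {Some (rt e)} \<Longrightarrow> q e v \<in> W e" "fst (D e) = parent_edges (W e) (Some (rt e)) (q e)"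
      and g: "v \<in> W e - {Some (rt e)} \<Longrightarrow> (g e (q e v) :: nat) < g e v" if "e \<in> E" for e v
      using choice[OF that] by (simp_all add: deco_props_def)
    \<comment> \<open>Within an edge the parent comes from the decoration; at the root of the
      decoration it jumps to the petiole.\<close>
    define p where "p = (\<lambda>i\<in>I. if i = rt (ed i) then pet (ed i) else q (ed i) (Some i))"
    define t where "t = (\<lambda>i\<in>I. rt (ed i))"
    have inner: "\<exists>j. p i = Some j \<and> j \<in> I \<and> ed j = ed i \<and> g (ed i) (Some j) < g (ed i) (Some i)"
      if "i \<in> I" "i \<noteq> rt (ed i)" for i
    proof -
      have "Some i \<in> W (ed i) - {Some (rt (ed i))}" using that by (auto simp: W_def)
      from q(1)[OF ed[OF that(1)] this] g[OF ed[OF that(1)] this] show ?thesis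
        using that by (auto simp: p_def W_def)
    qed
    have outer: "p i = pet (ed i)" if "i \<in> I" "i = rt (ed i)" for i
      using that by (simp add: p_def)
    \<comment> \<open>\<open>M\<close> exceeds every rank inside a decoration, so that
      \<open>h * M + g\<close> orders lexicographically.\<close>
    define M where "M = Suc (\<Sum>i\<in>I. g (ed i) (Some i))"
    have M: "g (ed i) (Some i) < M" if "i \<in> I" for i
      unfolding M_def using member_le_sum[of i I "\<lambda>i. g (ed i) (Some i)"] that fin by (simp add: le_imp_less_Suc)
    interpret cut_tree I p t
    proof
      show "finite I" by (rule fin)
      have "p i \<in> with_gap I" if "i \<in> I" for i
        using inner[OF that] outer[OF that] pet[OF ed[OF that]] by (cases "i = rt (ed i)") auto
      then show "p \<in> I \<rightarrow>\<^sub>E with_gap I" by (intro PiE_I) (auto simp: p_def)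
      show "t \<in> I \<rightarrow>\<^sub>E I" using rt(2) ed by (auto simp: t_def)
      obtain e0 where e0: "e0 \<in> E" "None \<in> e0" "\<And>e. e \<in> E \<Longrightarrow> None \<in> e \<Longrightarrow> e = e0" using ex1 by blast
      show "\<exists>!r. r \<in> I \<and> p r = None"
      proof (rule ex1I[of _ "rt e0"])
        have "pet e0 = None" using edge_iff[OF e0(1), of None] e0(2) by simp
        then show "rt e0 \<in> I \<and> p (rt e0) = None" using rt(2,3)[OF e0(1)] outer[of "rt e0"] by simp
        fix r assume r: "r \<in> I \<and> p r = None"
        then have eq: "r = rt (ed r)" using inner[of r] by auto
        then have "pet (ed r) = None" using outer[of r] r by simp
        then have "None \<in> ed r" using edge_iff[OF ed, of r] r by metis
        then show "r = rt e0" using e0(3)[of "ed r"] r ed eq by auto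
      qed
      show "\<exists>k :: 'a \<Rightarrow> nat. \<forall>i\<in>I. \<forall>j. p i = Some j \<longrightarrow> k j < k i"
      proof (intro exI[of _ "\<lambda>i. h (ed i) * M + g (ed i) (Some i)"] ballI allI impI)
        fix i j assume i: "i \<in> I" and j: "p i = Some j"
        show "h (ed j) * M + g (ed j) (Some j) < h (ed i) * M + g (ed i) (Some i)"
        proof (cases "i = rt (ed i)")
          case True
          then have pj: "pet (ed i) = Some j" using outer i j by simp
          then have "j \<in> I" using pet[OF ed[OF i]] by simp
          then have "h (ed j) * M + g (ed j) (Some j) < (h (ed j) + 1) * M" using M by simp
          also have "\<dots> \<le> h (ed i) * M" using h[OF ed[OF i] pj] by (intro mult_right_mono) auto
          finally show ?thesis by simp
        next
          case False
          then show ?thesis using inner[OF i False] j by auto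
        qed
      qed
      fix i assume i: "i \<in> I"
      show "t i = i \<or> (\<exists>j. p i = Some j \<and> t i = t j)"
        using inner[OF i] i by (cases "i = rt (ed i)") (auto simp: t_def)
    qed
    have tI: "t i = rt (ed i)" and pI: "p i = (if i = rt (ed i) then pet (ed i) else q (ed i) (Some i))"
      if "i \<in> I" for i
      using that by (simp_all add: t_def p_def)
    have tops: "tops = rt ` E"
    proof
      show "tops \<subseteq> rt ` E"
      proof
        fix u assume "u \<in> tops"
        then have "u \<in> I" "u = rt (ed u)" by (auto simp: tops_def tI)
        then show "u \<in> rt ` E" using ed by blast
      qed
      show "rt ` E \<subseteq> tops" using rt(2,3) by (auto simp: tops_def tI)
    qed
    have block: "block (rt e) = {i \<in> I. ed i = e}" if "e \<in> E" for e
    proof -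
      have "rt (ed v) = rt e \<longleftrightarrow> ed v = e" if "v \<in> I" for v
        using rt(3)[OF ed[OF that]] rt(3)[OF \<open>e \<in> E\<close>] by metis
      then show ?thesis by (auto simp: block_def tI)
    qed
    have edges: "edge (rt e) = e" if "e \<in> E" for e
      using outer[of "rt e"] rt(2,3)[OF that] edge[OF that, symmetric] by (simp add: edge_def block[OF that])
    have E: "edge ` tops = E" using edges by (simp add: tops image_image)
    have "snd hollow e = D e" for e
    proof (cases "e \<in> E")
      case True
      have "parent_edges (W e) (Some (rt e)) (p \<circ> the) = parent_edges (W e) (Some (rt e)) (q e)"
        by (rule parent_edges_cong) (auto simp: W_def pI split: if_splits)
      then have "deco (rt e) = (fst (D e), snd (D e))"
        by (simp only: deco_def block[OF True] q(2)[OF True] rt(1)[OF True] W_def)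
      then show ?thesis using hollow_apply[of "rt e"] edges[OF True] True by (simp add: tops)
    next
      case False
      \<comment> \<open>Outside \<open>E\<close> both decorations are
        \<open>undefined\<close>.\<close>
      then show ?thesis using PiE_arb[OF D False] by (simp add: hollow_def E)
    qed
    then have "hollow = (E, D)" using E by (auto simp: hollow_def intro!: prod_eqI)
    then show ?thesis using cut_tree_axioms by blast
  qed
qed

lemma bij_betw_hollow:
  "bij_betw (\<lambda>(p, t). cut_tree.hollow I p t) (cut_trees I) (hollow_PreLie_hypertrees I)"
  unfolding bij_betw_def
proof
  show "inj_on (\<lambda>(p, t). cut_tree.hollow I p t) (cut_trees I)"
    using hollow_inject by (fastforce simp: inj_on_def cut_trees_def)
  show "(\<lambda>(p, t). cut_tree.hollow I p t) ` cut_trees I = hollow_PreLie_hypertrees I"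
  proof
    show "(\<lambda>(p, t). cut_tree.hollow I p t) ` cut_trees I \<subseteq> hollow_PreLie_hypertrees I"
      using cut_tree.hollow_in by (auto simp: cut_trees_def)
    show "hollow_PreLie_hypertrees I \<subseteq> (\<lambda>(p, t). cut_tree.hollow I p t) ` cut_trees I"
    proof
      fix x assume "x \<in> hollow_PreLie_hypertrees I"
      then obtain p t where "cut_tree I p t" "cut_tree.hollow I p t = x"
        using hollow_surj by (cases x) blast
      then show "x \<in> (\<lambda>(p, t). cut_tree.hollow I p t) ` cut_trees I"
        by (auto simp: cut_trees_def intro: image_eqI[of _ _ "(p, t)"])
    qed
  qed
qed

text \<open>\<open>parent_edges_eqD\<close> recovers \<open>p\<close>. The fixed points of
  \<open>t\<close> are the marked vertices and the root, and every other value is inherited from the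
  parent, so \<open>t\<close> follows by induction on the rank.\<close>

lemma rooted_inject:
  assumes "cut_tree I p t" "cut_tree I p' t'" "cut_tree.rooted I p t = cut_tree.rooted I p' t'"
  shows "p = p' \<and> t = t'"
proof -
  interpret A: cut_tree I p t by fact
  interpret B: cut_tree I p' t' by fact
  have root: "A.root = B.root" using assms(3) by (simp add: A.rooted_def B.rooted_def)
  have "A.tops - {A.root} = B.tops - {A.root}"
    using assms(3) root by (simp add: A.rooted_def B.rooted_def)
  then have tops: "A.tops = B.tops" using A.root_in_tops B.root_in_tops root by (metis insert_Diff)
  have edges: "parent_edges I A.root (the \<circ> p) = parent_edges I A.root (the \<circ> p')"
    using assms(3) root by (simp add: A.rooted_def B.rooted_def)
  have p: "p i = p' i" if i: "i \<in> I" for i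
  proof (cases "i = A.root")
    case True
    then show ?thesis using A.root(2) B.root(2) root by simp
  next
    case False
    then have "(the \<circ> p) i = (the \<circ> p') i"
      using A.rooted_parent_fun B.rooted_parent_fun edges i
      by (intro parent_edges_eqD[of I A.root "the \<circ> p" "the \<circ> p'"]) (auto simp: root)
    moreover have "p i \<noteq> None" "p' i \<noteq> None" using False i A.root(3) B.root(3) root by metis+
    ultimately show ?thesis by auto
  qed
  obtain h :: "'a \<Rightarrow> nat" where h: "\<forall>i\<in>I. \<forall>j. p i = Some j \<longrightarrow> h j < h i"
    using A.ex_rank by blast
  have t: "t i = t' i" if "i \<in> I" for i
    using that
  proof (induction "h i" arbitrary: i rule: less_induct)
    case less
    show ?case
    proof (cases "i \<in> A.tops")
      case True
      moreover have "i \<in> B.tops" using True tops by simp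
      ultimately show ?thesis by (simp add: A.tops_def B.tops_def)
    next
      case False
      then have ne: "t i \<noteq> i" "t' i \<noteq> i" using less.prems tops by (auto simp: A.tops_def B.tops_def)
      then obtain j where j: "p i = Some j" "t i = t j" using A.t_cases less.prems by blast
      then have "t' i = t' j" using B.t_cases[OF less.prems] ne p[OF less.prems] by auto
      then show ?thesis using less.hyps[of j] h less.prems j A.p_Some by auto
    qed
  qed
  show ?thesis
    using PiE_ext[OF A.p_funcset B.p_funcset] PiE_ext[OF A.t_funcset B.t_funcset] p t by blast
qed

text \<open>\<open>t\<close> sends a vertex to the first element of \<open>insert r U\<close> met on
  the way up to the root.\<close>

lemma rooted_surj:
  assumes "finite I" "(T, r) \<in> rooted_trees I" "U \<subseteq> I - {r}"
  shows "\<exists>p t. cut_tree I p t \<and> cut_tree.rooted I p t = ((T, r), U)"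
proof -
  have tree: "tree I T" "r \<in> I" using assms(2) by (auto simp: rooted_trees_def)
  then obtain q where q: "parent_fun I r q" "T = parent_edges I r q" by (rule tree_imp_parent_fun)
  then obtain h :: "'a \<Rightarrow> nat" where h: "\<forall>v\<in>I - {r}. h (q v) < h v"
    by (auto simp: parent_fun_def)
  have qI: "q v \<in> I" if "v \<in> I" "v \<noteq> r" for v using q(1) that by (auto simp: parent_fun_def)
  have "v \<in> I \<Longrightarrow> v \<notin> insert r U \<Longrightarrow> q v \<in> I \<and> h (q v) < h v" for v
    using h qI by auto
  then obtain t where t: "\<And>v. v \<in> I \<Longrightarrow> v \<in> insert r U \<Longrightarrow> t v = v"
    "\<And>v. v \<in> I \<Longrightarrow> v \<notin> insert r U \<Longrightarrow> t v = t (q v)"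
    "\<And>v. v \<in> I \<Longrightarrow> t v \<in> I \<inter> insert r U"
    using first_hit[of I "insert r U" q h] by metis
  define p where "p = (\<lambda>i\<in>I. if i = r then None else Some (q i))"
  define t' where "t' = restrict t I"
  interpret cut_tree I p t'
  proof
    show "\<exists>h :: 'a \<Rightarrow> nat. \<forall>i\<in>I. \<forall>j. p i = Some j \<longrightarrow> h j < h i"
      using h by (intro exI[of _ h]) (auto simp: p_def)
    fix i assume i: "i \<in> I"
    show "t' i = i \<or> (\<exists>j. p i = Some j \<and> t' i = t' j)"
      using t(1,2)[OF i] i qI[OF i] by (cases "i \<in> insert r U") (auto simp: p_def t'_def)
  qed (use assms t(3) tree qI in \<open>auto simp: p_def t'_def split: if_splits\<close>)
  have r: "root = r" using root(3)[of r] tree by (simp add: p_def)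
  have "t' u = u \<longleftrightarrow> u \<in> insert r U" if "u \<in> I" for u
    using t(1)[OF that] t(3)[OF that] that by (auto simp: t'_def)
  then have "tops = insert r U" using tree assms(3) unfolding tops_def by blast
  moreover have "parent_edges I r (the \<circ> p) = T"
    unfolding q(2) by (rule parent_edges_cong) (auto simp: p_def)
  ultimately have "rooted = ((T, r), U)" using assms(3) by (auto simp: rooted_def r)
  then show ?thesis using cut_tree_axioms by blast
qed

lemma bij_betw_rooted:
  assumes "finite I"
  shows "bij_betw (\<lambda>(p, t). cut_tree.rooted I p t) (cut_trees I)
    (Sigma (rooted_trees I) (\<lambda>(T, r). Pow (I - {r})))"
  unfolding bij_betw_def
proof
  show "inj_on (\<lambda>(p, t). cut_tree.rooted I p t) (cut_trees I)"
    using rooted_inject by (fastforce simp: inj_on_def cut_trees_def)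
  show "(\<lambda>(p, t). cut_tree.rooted I p t) ` cut_trees I
      = Sigma (rooted_trees I) (\<lambda>(T, r). Pow (I - {r}))" (is "?L = ?R")
  proof
    show "?L \<subseteq> ?R"
    proof
      fix x assume "x \<in> ?L"
      then obtain p t where "cut_tree I p t" "x = cut_tree.rooted I p t" by (auto simp: cut_trees_def)
      then show "x \<in> ?R" using cut_tree.rooted_in by blast
    qed
    show "?R \<subseteq> ?L"
    proof
      fix x assume "x \<in> ?R"
      then obtain T r U where x: "x = ((T, r), U)" "(T, r) \<in> rooted_trees I" "U \<subseteq> I - {r}" by auto
      then obtain p t where "cut_tree I p t \<and> cut_tree.rooted I p t = x"
        using rooted_surj[OF assms] by blast
      then show "x \<in> ?L" by (auto simp: cut_trees_def intro: image_eqI[of _ _ "(p, t)"])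
    qed
  qed
qed

section \<open>Cycles and stable subsets\<close>

definition cycles :: "'a set \<Rightarrow> ('a \<Rightarrow> 'a) \<Rightarrow> 'a set set" where
  "cycles A \<sigma> = orbit \<sigma> ` A"

text \<open>This multiset of cycle lengths is literally the monomial contributed by the permutation
  to a cycle index series.\<close>

definition cycle_type :: "'a set \<Rightarrow> ('a \<Rightarrow> 'a) \<Rightarrow> nat multiset" where
  "cycle_type A \<sigma> = image_mset card (mset_set (cycles A \<sigma>))"

context
  fixes A :: "'a set" and \<sigma> :: "'a \<Rightarrow> 'a"
  assumes fin: "finite A" and perm: "\<sigma> permutes A"
begin

lemma permutation: "permutation \<sigma>"
  using fin perm by (auto simp: permutation_permutes)

lemma orbit_unique: "y \<in> orbit \<sigma> x \<Longrightarrow> orbit \<sigma> y = orbit \<sigma> x"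
  by (rule orbit_cyclic_eq3[OF cyclic_on_orbit[OF perm fin]])

lemma self_in_orbit: "x \<in> orbit \<sigma> x"
  by (rule permutation_self_in_orbit[OF permutation])

lemma orbit_subset_set: "x \<in> A \<Longrightarrow> orbit \<sigma> x \<subseteq> A"
  using perm by (rule permutes_orbit_subset)

lemma finite_cycles: "finite (cycles A \<sigma>)"
  using fin by (simp add: cycles_def)

lemma cycle_props:
  assumes "C \<in> cycles A \<sigma>"
  shows "C \<subseteq> A" "finite C" "C \<noteq> {}"
proof -
  show "C \<subseteq> A" using assms orbit_subset_set unfolding cycles_def by blast
  then show "finite C" using fin by (rule finite_subset)
  show "C \<noteq> {}" using assms self_in_orbit by (auto simp: cycles_def)
qed

lemma disjoint_cycles:
  "C \<in> cycles A \<sigma> \<Longrightarrow> C' \<in> cycles A \<sigma> \<Longrightarrow> C \<noteq> C' \<Longrightarrow> C \<inter> C' = {}"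
  using orbit_unique unfolding cycles_def by (metis disjoint_iff imageE)

lemma Union_cycles: "\<Union> (cycles A \<sigma>) = A"
  using orbit_subset_set self_in_orbit unfolding cycles_def by blast

lemma card_Union_cycles:
  assumes "S \<subseteq> cycles A \<sigma>"
  shows "card (\<Union>S) = (\<Sum>C\<in>S. card C)"
proof (rule card_Union_disjoint)
  show "pairwise disjnt S"
  proof (rule pairwiseI)
    fix C C' assume "C \<in> S" "C' \<in> S" "C \<noteq> C'"
    then show "disjnt C C'" using disjoint_cycles[of C C'] assms by (auto simp: disjnt_def)
  qed
qed (use assms cycle_props(2) in blast)

lemma sum_mset_cycle_type: "sum_mset (cycle_type A \<sigma>) = card A"
  using card_Union_cycles[OF subset_refl] by (simp add: cycle_type_def Union_cycles sum_unfold_sum_mset)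

text \<open>A stable set contains the orbits of its points, hence is a union of cycles; cycles are
  nonempty and disjoint, so the union determines which ones occur.\<close>

lemma bij_betw_stable_subsets:
  "bij_betw Union (Pow (cycles A \<sigma>)) {U. U \<subseteq> A \<and> \<sigma> ` U = U}"
  unfolding bij_betw_def
proof
  show "inj_on Union (Pow (cycles A \<sigma>))"
  proof (rule inj_onI)
    have sub: "S \<subseteq> S'" if S: "S \<subseteq> cycles A \<sigma>" "S' \<subseteq> cycles A \<sigma>" "\<Union>S = \<Union>S'" for S S'
    proof
      fix C assume C: "C \<in> S"
      then have "C \<noteq> {}" using S(1) cycle_props(3) by blast
      then obtain x where x: "x \<in> C" by blast
      then obtain C' where "C' \<in> S'" "x \<in> C'" using C S(3) by blast
      then show "C \<in> S'" using disjoint_cycles[of C C'] x C S by blast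
    qed
    show "S = S'" if "S \<in> Pow (cycles A \<sigma>)" "S' \<in> Pow (cycles A \<sigma>)" "\<Union>S = \<Union>S'" for S S'
      using sub[of S S'] sub[of S' S] that by auto
  qed
  show "Union ` Pow (cycles A \<sigma>) = {U. U \<subseteq> A \<and> \<sigma> ` U = U}"
  proof
    have stable: "\<sigma> ` C = C" if C: "C \<in> cycles A \<sigma>" for C
    proof (rule card_subset_eq[OF cycle_props(2)[OF C]])
      show "\<sigma> ` C \<subseteq> C" using C by (auto simp: cycles_def intro: orbit.step)
      show "card (\<sigma> ` C) = card C"
        using perm by (intro card_image inj_on_subset[OF permutes_inj]) auto
    qed
    have "\<sigma> ` \<Union>S = \<Union>S" if "S \<subseteq> cycles A \<sigma>" for S
    proof -
      have "(`) \<sigma> ` S = id ` S" using stable that by (intro image_cong) auto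
      then show ?thesis by (simp add: image_Union)
    qed
    moreover have "\<Union>S \<subseteq> A" if "S \<subseteq> cycles A \<sigma>" for S
      using cycle_props(1) that by blast
    ultimately show "Union ` Pow (cycles A \<sigma>) \<subseteq> {U. U \<subseteq> A \<and> \<sigma> ` U = U}" by blast
    show "{U. U \<subseteq> A \<and> \<sigma> ` U = U} \<subseteq> Union ` Pow (cycles A \<sigma>)"
    proof
      fix U assume "U \<in> {U. U \<subseteq> A \<and> \<sigma> ` U = U}"
      then have U: "U \<subseteq> A" "\<sigma> ` U = U" by auto
      have "y \<in> U" if "x \<in> U" "y \<in> orbit \<sigma> x" for x y
        using that(2) by induction (use U that(1) in auto)
      then have "\<Union> (orbit \<sigma> ` U) \<subseteq> U" by blast
      then have "U = \<Union> (orbit \<sigma> ` U)" using self_in_orbit by (intro equalityI) auto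
      moreover have "orbit \<sigma> ` U \<in> Pow (cycles A \<sigma>)" using U(1) by (auto simp: cycles_def)
      ultimately show "U \<in> Union ` Pow (cycles A \<sigma>)" by (rule image_eqI)
    qed
  qed
qed

text \<open>Expanding the product chooses, for each cycle, whether it is contained in the stable
  subset.\<close>

lemma sum_stable_subsets:
  fixes x :: "'b :: comm_ring_1"
  shows "(\<Sum>U | U \<subseteq> A \<and> \<sigma> ` U = U. x ^ card U) = (\<Prod>k\<in>#cycle_type A \<sigma>. 1 + x ^ k)"
proof -
  have "(\<Sum>U | U \<subseteq> A \<and> \<sigma> ` U = U. x ^ card U) = (\<Sum>S\<in>Pow (cycles A \<sigma>). x ^ card (\<Union>S))"
    by (rule sum.reindex_bij_betw[OF bij_betw_stable_subsets, of "\<lambda>U. x ^ card U", symmetric])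
  \<comment> \<open>The trivial factor over the omitted cycles produces the shape expanded by
    \<open>prod_add\<close>.\<close>
  also have "\<dots> = (\<Sum>S\<in>Pow (cycles A \<sigma>). (\<Prod>C\<in>S. x ^ card C) * (\<Prod>C\<in>cycles A \<sigma> - S. 1))"
    by (rule sum.cong) (auto simp: card_Union_cycles power_sum)
  also have "\<dots> = (\<Prod>C\<in>cycles A \<sigma>. x ^ card C + 1)"
    by (rule prod_add[OF finite_cycles, symmetric])
  also have "\<dots> = (\<Prod>k\<in>#cycle_type A \<sigma>. 1 + x ^ k)"
    by (simp add: cycle_type_def prod_unfold_prod_mset image_mset.compositionality comp_def add.commute)
  finally show ?thesis .
qed

text \<open>A fixed point can be added to or removed from a stable subset.\<close>

lemma sum_stable_subsets_avoiding:
  fixes x :: "'b :: comm_ring_1"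
  assumes r: "r \<in> A" "\<sigma> r = r"
  shows "(1 + x) * (\<Sum>U | U \<subseteq> A - {r} \<and> \<sigma> ` U = U. x ^ card U) = (\<Prod>k\<in>#cycle_type A \<sigma>. 1 + x ^ k)"
proof -
  let ?S = "{U. U \<subseteq> A - {r} \<and> \<sigma> ` U = U}"
  have fS: "finite ?S" by (rule finite_subset[of _ "Pow A"]) (use fin in auto)
  have inj: "inj_on (insert r) ?S" by (rule inj_onI) blast
  have eq: "{U. U \<subseteq> A \<and> \<sigma> ` U = U} = ?S \<union> insert r ` ?S"
  proof
    show "{U. U \<subseteq> A \<and> \<sigma> ` U = U} \<subseteq> ?S \<union> insert r ` ?S"
    proof
      fix U assume U: "U \<in> {U. U \<subseteq> A \<and> \<sigma> ` U = U}"
      show "U \<in> ?S \<union> insert r ` ?S"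
      proof (cases "r \<in> U")
        case True
        have "\<sigma> ` (U - {r}) = U - {r}"
          using U r(2) image_set_diff[OF permutes_inj[OF perm], of U "{r}"] by auto
        then have "U - {r} \<in> ?S" using U by auto
        moreover have "U = insert r (U - {r})" using True by auto
        ultimately show ?thesis by blast
      qed (use U in auto)
    qed
  qed (use r in auto)
  have "(\<Sum>U\<in>insert r ` ?S. x ^ card U) = (\<Sum>U\<in>?S. x * x ^ card U)"
    unfolding sum.reindex[OF inj] comp_def
  proof (rule sum.cong)
    fix U assume "U \<in> ?S"
    then have "r \<notin> U" "finite U" using fin by (auto intro: finite_subset)
    then show "x ^ card (insert r U) = x * x ^ card U" by simp
  qed simp
  then have "(\<Sum>U | U \<subseteq> A \<and> \<sigma> ` U = U. x ^ card U) = (\<Sum>U\<in>?S. x ^ card U) + (\<Sum>U\<in>?S. x * x ^ card U)"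
    unfolding eq using fS by (subst sum.union_disjoint) auto
  then show ?thesis by (simp add: sum_stable_subsets algebra_simps flip: sum_distrib_left)
qed

lemma prod_num_cycles:
  fixes g :: "nat \<Rightarrow> 'b :: comm_monoid_mult"
  assumes "card A \<le> n"
  shows "(\<Prod>k\<in>#cycle_type A \<sigma>. g k) = (\<Prod>i=1..n. g i ^ card {C \<in> cycles A \<sigma>. card C = i})"
proof -
  have "(\<Prod>k\<in>#cycle_type A \<sigma>. g k) = (\<Prod>C\<in>cycles A \<sigma>. g (card C))"
    by (simp add: cycle_type_def prod_unfold_prod_mset image_mset.compositionality comp_def)
  also have "\<dots> = (\<Prod>i=1..n. \<Prod>C | C \<in> cycles A \<sigma> \<and> card C = i. g (card C))"
  proof (rule prod.group[symmetric])
    show "card ` cycles A \<sigma> \<subseteq> {1..n}"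
    proof safe
      fix C assume "C \<in> cycles A \<sigma>"
      note C = cycle_props[OF this]
      have "card C \<noteq> 0" using C by simp
      moreover have "card C \<le> n" using card_mono[OF fin C(1)] assms by simp
      ultimately show "card C \<in> {1..n}" by simp
    qed
  qed (simp_all add: finite_cycles)
  also have "\<dots> = (\<Prod>i=1..n. g i ^ card {C \<in> cycles A \<sigma>. card C = i})"
    by (intro prod.cong) simp_all
  finally show ?thesis .
qed

end

section \<open>Equivariance\<close>

lemma parent_edges_image:
  assumes "r \<in> V" "inj_on f V" "\<And>v. v \<in> V - {r} \<Longrightarrow> q (f v) = f (p v)"
  shows "parent_edges (f ` V) (f r) q = (`) f ` parent_edges V r p"
proof -
  have "f ` V - {f r} = f ` (V - {r})" using assms(1,2) by (auto simp: inj_on_def)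
  then show ?thesis using assms(3) by (simp add: parent_edges_def image_image)
qed

text \<open>Prescribing the relabelled pair at the points \<open>\<sigma> i\<close> keeps
  \<open>inv \<sigma>\<close> out of the transport of all derived data.\<close>

context
  fixes I :: "'a set" and p t p' t' \<sigma>
  assumes A: "cut_tree I p t" and B: "cut_tree I p' t'" and perm: "\<sigma> permutes I"
    and p': "\<And>i. i \<in> I \<Longrightarrow> p' (\<sigma> i) = map_option \<sigma> (p i)"
    and t': "\<And>i. i \<in> I \<Longrightarrow> t' (\<sigma> i) = \<sigma> (t i)"
begin

interpretation A: cut_tree I p t by (rule A)
interpretation B: cut_tree I p' t' by (rule B)

lemma inj_relabel: "inj \<sigma>" "inj (map_option \<sigma>)"
  using permutes_inj[OF perm] by (simp_all add: option.inj_map)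

lemma permutes_preimage:
  assumes "x \<in> I"
  obtains y where "y \<in> I" "x = \<sigma> y"
  using assms permutes_image[OF perm] by auto

lemma permutes_in_iff: "\<sigma> i \<in> I \<longleftrightarrow> i \<in> I"
  by (rule permutes_in_image[OF perm])

lemma tops_relabel: "B.tops = \<sigma> ` A.tops"
proof
  show "B.tops \<subseteq> \<sigma> ` A.tops"
  proof
    fix u assume "u \<in> B.tops"
    then have u: "u \<in> I" "t' u = u" by (auto simp: B.tops_def)
    from u(1) obtain v where v: "v \<in> I" "u = \<sigma> v" by (rule permutes_preimage)
    then have "t v = v" using u(2) t'[OF v(1)] inj_relabel(1) by (simp add: inj_eq)
    then show "u \<in> \<sigma> ` A.tops" using v by (auto simp: A.tops_def)
  qed
  show "\<sigma> ` A.tops \<subseteq> B.tops"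
    by (auto simp: A.tops_def B.tops_def permutes_in_iff t')
qed

lemma block_relabel: "B.block (\<sigma> u) = \<sigma> ` A.block u"
proof
  show "B.block (\<sigma> u) \<subseteq> \<sigma> ` A.block u"
  proof
    fix x assume "x \<in> B.block (\<sigma> u)"
    then have x: "x \<in> I" "t' x = \<sigma> u" by (auto simp: B.block_def)
    from x(1) obtain v where v: "v \<in> I" "x = \<sigma> v" by (rule permutes_preimage)
    then have "t v = u" using x(2) t'[OF v(1)] inj_relabel(1) by (simp add: inj_eq)
    then show "x \<in> \<sigma> ` A.block u" using v by (auto simp: A.block_def)
  qed
  show "\<sigma> ` A.block u \<subseteq> B.block (\<sigma> u)"
    by (auto simp: A.block_def B.block_def permutes_in_iff t')
qed

lemma edge_relabel: "u \<in> I \<Longrightarrow> B.edge (\<sigma> u) = map_option \<sigma> ` A.edge u"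
  by (simp add: A.edge_def B.edge_def p' block_relabel image_image)

lemma deco_relabel:
  assumes "u \<in> A.tops"
  shows "B.deco (\<sigma> u) = relabel_rooted_tree (map_option \<sigma>) (A.deco u)"
proof -
  let ?V = "Some ` A.block u"
  have "parent_edges (map_option \<sigma> ` ?V) (map_option \<sigma> (Some u)) (p' \<circ> the)
      = (`) (map_option \<sigma>) ` parent_edges ?V (Some u) (p \<circ> the)"
  proof (rule parent_edges_image)
    show "Some u \<in> ?V" using A.in_block[OF assms] by blast
    show "inj_on (map_option \<sigma>) ?V" by (rule inj_on_subset[OF inj_relabel(2)]) simp
    fix v assume "v \<in> ?V - {Some u}"
    then show "(p' \<circ> the) (map_option \<sigma> v) = map_option \<sigma> ((p \<circ> the) v)"
      by (auto simp: A.block_def p')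
  qed
  moreover have "map_option \<sigma> ` ?V = Some ` B.block (\<sigma> u)"
    by (simp add: block_relabel image_image)
  ultimately show ?thesis by (simp add: A.deco_def B.deco_def relabel_rooted_tree_def)
qed

lemma hollow_relabel: "B.hollow = relabel_decorated_hypertree \<sigma> A.hollow"
proof -
  let ?f = "map_option \<sigma>"
  have E: "B.edge ` B.tops = (`) ?f ` A.edge ` A.tops"
    unfolding tops_relabel image_image
    using edge_relabel A.tops_subset by (intro image_cong) auto
  have "snd B.hollow e = (\<lambda>e\<in>B.edge ` B.tops. relabel_rooted_tree ?f (snd A.hollow (?f -` e))) e" for e
  proof (cases "e \<in> B.edge ` B.tops")
    case True
    then obtain u where u: "u \<in> A.tops" "e = B.edge (\<sigma> u)" unfolding tops_relabel by blast
    then have "e = ?f ` A.edge u" using edge_relabel A.tops_subset by blast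
    \<comment> \<open>The preimage in \<open>relabel_decorated_hypertree\<close> recovers the
      original edge because \<open>?f\<close> is injective.\<close>
    then have "?f -` e = A.edge u" by (simp only: inj_vimage_image_eq[OF inj_relabel(2)])
    moreover have "snd B.hollow e = B.deco (\<sigma> u)"
      unfolding u(2) by (rule B.hollow_apply) (use u tops_relabel in blast)
    ultimately show ?thesis
      using True A.hollow_apply[OF u(1)] deco_relabel[OF u(1)] by simp
  next
    case False
    then show ?thesis by (simp add: B.hollow_def)
  qed
  then have "snd B.hollow = (\<lambda>e\<in>B.edge ` B.tops. relabel_rooted_tree ?f (snd A.hollow (?f -` e)))"
    by (rule ext)
  moreover have "fst B.hollow = B.edge ` B.tops" "fst A.hollow = A.edge ` A.tops"
    by (simp_all add: A.hollow_def B.hollow_def)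
  ultimately show ?thesis
    unfolding relabel_decorated_hypertree_def Let_def
    by (intro prod_eqI) (simp_all add: case_prod_beta E)
qed

lemma rooted_relabel:
  "B.rooted = (relabel_rooted_tree \<sigma> (fst A.rooted), \<sigma> ` snd A.rooted)"
proof -
  have root: "B.root = \<sigma> A.root"
    using B.root(3)[of "\<sigma> A.root"] A.root(1,2) by (simp add: permutes_in_iff p')
  have "parent_edges (\<sigma> ` I) (\<sigma> A.root) (the \<circ> p') = (`) \<sigma> ` parent_edges I A.root (the \<circ> p)"
  proof (rule parent_edges_image)
    show "inj_on \<sigma> I" by (rule inj_on_subset[OF inj_relabel(1)]) simp
    fix v assume v: "v \<in> I - {A.root}"
    then have "p v \<noteq> None" using A.root(3) by blast
    then show "(the \<circ> p') (\<sigma> v) = \<sigma> ((the \<circ> p) v)" using v by (auto simp: p')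
  qed (rule A.root)
  moreover have "\<sigma> ` A.tops - {\<sigma> A.root} = \<sigma> ` (A.tops - {A.root})"
    using inj_relabel(1) by (simp add: image_set_diff)
  ultimately show ?thesis
    by (simp add: A.rooted_def B.rooted_def relabel_rooted_tree_def root tops_relabel permutes_image[OF perm])
qed

end

section \<open>Relabelling cut trees and counting fixed structures\<close>

definition cut_relabel :: "'a set \<Rightarrow> ('a \<Rightarrow> 'a) \<Rightarrow> ('a \<Rightarrow> 'a option) \<times> ('a \<Rightarrow> 'a) \<Rightarrow>
    ('a \<Rightarrow> 'a option) \<times> ('a \<Rightarrow> 'a)" where
  "cut_relabel I \<sigma> = (\<lambda>(p, t). (\<lambda>i\<in>I. map_option \<sigma> (p (inv \<sigma> i)), \<lambda>i\<in>I. \<sigma> (t (inv \<sigma> i))))"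

lemma cut_relabel_in:
  assumes "q \<in> cut_trees I" "\<sigma> permutes I"
  shows "cut_relabel I \<sigma> q \<in> cut_trees I"
proof -
  obtain p t where q: "q = (p, t)" "cut_tree I p t" using assms(1) by (auto simp: cut_trees_def)
  interpret cut_tree I p t by fact
  note perm = assms(2)
  have inv: "inv \<sigma> i \<in> I" if "i \<in> I" for i
    using permutes_in_image[OF permutes_inv[OF perm]] that by simp
  have inI: "\<sigma> i \<in> I" if "i \<in> I" for i using permutes_in_image[OF perm] that by simp
  have inverse [simp]: "inv \<sigma> (\<sigma> i) = i" "\<sigma> (inv \<sigma> i) = i" for i
    using permutes_inverses[OF perm] by simp_all
  define p' where "p' = (\<lambda>i\<in>I. map_option \<sigma> (p (inv \<sigma> i)))"
  define t' where "t' = (\<lambda>i\<in>I. \<sigma> (t (inv \<sigma> i)))"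
  have "cut_tree I p' t'"
  proof
    show "finite I" by (rule finite_I)
    have "p' i \<in> with_gap I" if "i \<in> I" for i
      using p_Some[OF inv[OF that]] inI that by (cases "p (inv \<sigma> i)") (auto simp: p'_def)
    then show "p' \<in> I \<rightarrow>\<^sub>E with_gap I" by (intro PiE_I) (auto simp: p'_def)
    show "t' \<in> I \<rightarrow>\<^sub>E I" using t_in inv inI by (auto simp: t'_def)
    show "\<exists>!r. r \<in> I \<and> p' r = None"
    proof (rule ex1I[of _ "\<sigma> root"])
      show "\<sigma> root \<in> I \<and> p' (\<sigma> root) = None" using root(1,2) inI by (simp add: p'_def)
      fix r assume r: "r \<in> I \<and> p' r = None"
      then have "inv \<sigma> r = root" using inv by (intro root(3)) (auto simp: p'_def)
      then show "r = \<sigma> root" by (metis inverse(2))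
    qed
    obtain h :: "'a \<Rightarrow> nat" where h: "\<forall>i\<in>I. \<forall>j. p i = Some j \<longrightarrow> h j < h i" using ex_rank by blast
    show "\<exists>h :: 'a \<Rightarrow> nat. \<forall>i\<in>I. \<forall>j. p' i = Some j \<longrightarrow> h j < h i"
      using h inv by (intro exI[of _ "h \<circ> inv \<sigma>"]) (auto simp: p'_def)
    fix i assume i: "i \<in> I"
    show "t' i = i \<or> (\<exists>j. p' i = Some j \<and> t' i = t' j)"
      using t_cases[OF inv[OF i]]
    proof
      assume "t (inv \<sigma> i) = inv \<sigma> i"
      then show ?thesis using i by (simp add: t'_def)
    next
      assume "\<exists>j. p (inv \<sigma> i) = Some j \<and> t (inv \<sigma> i) = t j"
      then obtain j where j: "p (inv \<sigma> i) = Some j" "t (inv \<sigma> i) = t j" by blast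
      then have "j \<in> I" using p_Some inv[OF i] by blast
      then show ?thesis using i j inI by (auto simp: p'_def t'_def)
    qed
  qed
  then show ?thesis by (simp add: q cut_relabel_def p'_def t'_def cut_trees_def)
qed

text \<open>By equivariance, \<open>k (f x) = f x\<close> says \<open>f (g x) = f x\<close>, and
  injectivity of \<open>f\<close> on \<open>A\<close> turns this into
  \<open>g x = x\<close>.\<close>

lemma bij_betw_fixed:
  assumes f: "bij_betw f A B" and g: "\<And>x. x \<in> A \<Longrightarrow> g x \<in> A" and comm: "\<And>x. x \<in> A \<Longrightarrow> f (g x) = k (f x)"
  shows "bij_betw f {x \<in> A. g x = x} {y \<in> B. k y = y}"
proof -
  have "g x = x \<longleftrightarrow> k (f x) = f x" if "x \<in> A" for x
    using bij_betw_imp_inj_on[OF f] g[OF that] that by (simp add: inj_on_eq_iff flip: comm[OF that])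
  then have "f ` {x \<in> A. g x = x} = {y \<in> B. k y = y}"
    using bij_betw_imp_surj_on[OF f] by auto
  then show ?thesis
    using bij_betw_imp_inj_on[OF f] by (auto simp: bij_betw_def inj_on_def)
qed

lemma finite_rooted_trees: "finite V \<Longrightarrow> finite (rooted_trees V)"
  by (rule finite_subset[of _ "Pow (Pow V) \<times> V"])
    (auto simp: rooted_trees_def tree_def simple_graph_def)

text \<open>Fixed hypertrees become pairs of a fixed rooted tree and a stable set avoiding its root.
  Every fixed tree contributes the same product, so only their number remains. Multiplying by
  \<open>1 + x\<close> avoids a division in a general commutative ring.\<close>

lemma sum_fixed_hollow:
  fixes x :: "'b :: comm_ring_1"
  assumes fin: "finite I" and perm: "\<sigma> permutes I"
  shows "(1 + x) * (\<Sum>s | s \<in> hollow_PreLie_hypertrees I \<and> relabel_decorated_hypertree \<sigma> s = s.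
        x ^ (card (fst s) - 1))
    = of_nat (card {T \<in> rooted_trees I. relabel_rooted_tree \<sigma> T = T}) * (\<Prod>k\<in>#cycle_type I \<sigma>. 1 + x ^ k)"
proof -
  define h where "h = (\<lambda>(p, t). cut_tree.hollow I p t)"
  define c where "c = (\<lambda>(p, t). cut_tree.rooted I p t)"
  define k where "k = (\<lambda>(T, U). (relabel_rooted_tree \<sigma> T, \<sigma> ` U))"
  let ?Q = "{q \<in> cut_trees I. cut_relabel I \<sigma> q = q}"
  let ?T = "{T \<in> rooted_trees I. relabel_rooted_tree \<sigma> T = T}"
  have hk: "h (cut_relabel I \<sigma> q) = relabel_decorated_hypertree \<sigma> (h q) \<and> c (cut_relabel I \<sigma> q) = k (c q)"
    if q: "q \<in> cut_trees I" for q
  proof -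
    obtain p t where pt: "q = (p, t)" "cut_tree I p t" using q by (auto simp: cut_trees_def)
    obtain p' t' where pt': "cut_relabel I \<sigma> q = (p', t')" "cut_tree I p' t'"
      using cut_relabel_in[OF q perm] by (auto simp: cut_trees_def)
    have *: "p' (\<sigma> i) = map_option \<sigma> (p i)" "t' (\<sigma> i) = \<sigma> (t i)" if "i \<in> I" for i
      using pt' pt that permutes_in_image[OF perm] permutes_inverses[OF perm]
      by (auto simp: cut_relabel_def)
    show ?thesis
      using hollow_relabel[OF pt(2) pt'(2) perm *] rooted_relabel[OF pt(2) pt'(2) perm *]
      by (simp add: pt(1) pt'(1)[unfolded pt(1)] h_def c_def k_def case_prod_beta)
  qed
  have h: "bij_betw h ?Q {s \<in> hollow_PreLie_hypertrees I. relabel_decorated_hypertree \<sigma> s = s}"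
    by (rule bij_betw_fixed) (use bij_betw_hollow hk cut_relabel_in perm in \<open>auto simp: h_def\<close>)
  have "bij_betw c ?Q {s \<in> Sigma (rooted_trees I) (\<lambda>(T, r). Pow (I - {r})). k s = s}"
    by (rule bij_betw_fixed) (use bij_betw_rooted[OF fin] hk cut_relabel_in perm in \<open>auto simp: c_def\<close>)
  also have "{s \<in> Sigma (rooted_trees I) (\<lambda>(T, r). Pow (I - {r})). k s = s}
      = Sigma ?T (\<lambda>T. {U. U \<subseteq> I - {snd T} \<and> \<sigma> ` U = U})"
    by (auto simp: k_def)
  finally have c: "bij_betw c ?Q (Sigma ?T (\<lambda>T. {U. U \<subseteq> I - {snd T} \<and> \<sigma> ` U = U}))" .
  have "(\<Sum>s | s \<in> hollow_PreLie_hypertrees I \<and> relabel_decorated_hypertree \<sigma> s = s. x ^ (card (fst s) - 1))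
      = (\<Sum>q\<in>?Q. x ^ (card (fst (h q)) - 1))"
    by (rule sum.reindex_bij_betw[OF h, symmetric])
  also have "\<dots> = (\<Sum>q\<in>?Q. x ^ card (snd (c q)))"
    by (rule sum.cong) (auto simp: h_def c_def cut_trees_def cut_tree.card_hollow simp del: One_nat_def)
  also have "\<dots> = (\<Sum>s\<in>Sigma ?T (\<lambda>T. {U. U \<subseteq> I - {snd T} \<and> \<sigma> ` U = U}). x ^ card (snd s))"
    by (rule sum.reindex_bij_betw[OF c])
  also have "\<dots> = (\<Sum>T\<in>?T. \<Sum>U | U \<subseteq> I - {snd T} \<and> \<sigma> ` U = U. x ^ card U)"
  proof (subst sum.Sigma)
    show "finite ?T" using finite_rooted_trees[OF fin] by simp
    show "\<forall>T\<in>?T. finite {U. U \<subseteq> I - {snd T} \<and> \<sigma> ` U = U}"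
      using fin by (auto intro: finite_subset[of _ "Pow I"])
  qed (simp add: case_prod_beta)
  finally have "(1 + x) * (\<Sum>s | s \<in> hollow_PreLie_hypertrees I \<and> relabel_decorated_hypertree \<sigma> s = s.
        x ^ (card (fst s) - 1))
      = (\<Sum>T\<in>?T. (1 + x) * (\<Sum>U | U \<subseteq> I - {snd T} \<and> \<sigma> ` U = U. x ^ card U))"
    by (simp add: sum_distrib_left)
  also have "\<dots> = (\<Sum>T\<in>?T. \<Prod>k\<in>#cycle_type I \<sigma>. 1 + x ^ k)"
  proof (rule sum.cong)
    fix T assume "T \<in> ?T"
    then have "snd T \<in> I" "\<sigma> (snd T) = snd T"
      by (auto simp: rooted_trees_def relabel_rooted_tree_def split: prod.splits)
    then show "(1 + x) * (\<Sum>U | U \<subseteq> I - {snd T} \<and> \<sigma> ` U = U. x ^ card U) = (\<Prod>k\<in>#cycle_type I \<sigma>. 1 + x ^ k)"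
      by (rule sum_stable_subsets_avoiding[OF fin perm])
  qed simp
  finally show ?thesis by simp
qed

section \<open>Coefficients\<close>

lemma pcoeff_zero [simp]: "pcoeff 0 m = 0"
  by transfer simp

lemma pcoeff_add [simp]: "pcoeff (f + g) m = pcoeff f m + pcoeff g m"
  by transfer simp

lemma pcoeff_sum: "pcoeff (\<Sum>i\<in>A. f i) m = (\<Sum>i\<in>A. pcoeff (f i) m)"
  by (induction A rule: infinite_finite_induct) simp_all

lemma pcoeff_mult: "pcoeff (f * g) m = (\<Sum>(a, b) | a + b = m. pcoeff f a * pcoeff g b)"
  by transfer simp

lemma pcoeff_pmonom: "pcoeff (pmonom c a) m = (if m = a then c else 0)"
  by transfer simp

lemma pcoeff_formal_sum: "pcoeff (formal_sum F) m = Sum_any (\<lambda>i. pcoeff (F i) m)"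
  by transfer simp

lemma Sum_any_single:
  assumes "\<And>i. i \<noteq> a \<Longrightarrow> f i = 0"
  shows "Sum_any f = f a"
  using assms by (subst Sum_any.expand_superset[of "{a}"]) auto

lemma pmonom_zero [simp]: "pmonom 0 a = (0 :: 'a :: comm_ring_1 pseries)"
  by (rule pseries_eqI) (simp add: pcoeff_pmonom)

lemma pcoeff_pmonom_mult:
  "pcoeff (pmonom c a * f) m = (if a \<subseteq># m then c * pcoeff f (m - a) else 0)"
proof -
  have "pcoeff (pmonom c a * f) m
      = (\<Sum>z \<in> {(x, y). x + y = m}. if z = (a, m - a) then c * pcoeff f (m - a) else 0)"
    unfolding pcoeff_mult
  proof (rule sum.cong)
    fix z assume "z \<in> {(x, y). x + y = m}"
    then obtain x y where z: "z = (x, y)" "m = x + y" by auto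
    show "(case z of (x, y) \<Rightarrow> pcoeff (pmonom c a) x * pcoeff f y)
        = (if z = (a, m - a) then c * pcoeff f (m - a) else 0)"
      by (cases "x = a") (auto simp: z pcoeff_pmonom)
  qed simp
  also have "\<dots> = (if a \<subseteq># m then c * pcoeff f (m - a) else 0)"
  proof -
    have "a + (m - a) = m \<longleftrightarrow> a \<subseteq># m"
      by (metis mset_subset_eq_add_left subset_mset.add_diff_inverse)
    then show ?thesis by (subst sum.delta) (simp_all add: finite_add_eq)
  qed
  finally show ?thesis .
qed

lemma pcoeff_pconst_mult: "pcoeff (pconst c * f) m = c * pcoeff f m"
  by (simp add: pconst_def pcoeff_pmonom_mult)

lemma pmonom_mult: "pmonom c a * pmonom d b = pmonom (c * d) (a + b)"
  by (rule pseries_eqI) (auto simp: pcoeff_pmonom_mult pcoeff_pmonom subset_mset.add_diff_inverse)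

lemma prod_mset_pmonom: "(\<Prod>k\<in>#m. pmonom (c k) {#k#}) = pmonom (\<Prod>k\<in>#m. c k) m"
proof (induction m)
  case empty
  show ?case by (rule pseries_eqI) (simp add: pcoeff_pmonom one_pseries.rep_eq)
qed (simp add: pmonom_mult)

lemma pconst_mult_pvar: "pconst c * pvar k = pmonom c {#k#}"
  by (simp add: pconst_def pvar_def pmonom_mult)

text \<open>Substituting a multiple of \<open>p_k\<close> for each \<open>p_k\<close> maps every
  monomial to a multiple of itself, so one term of the formal sum survives and summability is no
  concern.\<close>

lemma pcoeff_psubst_monomials:
  "pcoeff (psubst f (\<lambda>k. pmonom (c k) {#k#})) m = pcoeff f m * (\<Prod>k\<in>#m. c k)"
  unfolding psubst_def pcoeff_formal_sum
  by (subst Sum_any_single[of m]) (auto simp: pcoeff_pconst_mult prod_mset_pmonom pcoeff_pmonom)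

lemma adams_pmonom_1: "adams k (pmonom c {#1#}) = pmonom (fps_compose c (fps_X ^ k)) {#k#}"
proof (rule pseries_eqI)
  fix m
  show "pcoeff (adams k (pmonom c {#1#})) m = pcoeff (pmonom (fps_compose c (fps_X ^ k)) {#k#}) m"
    unfolding adams_def pcoeff_formal_sum
    by (subst Sum_any_single[of "{#1#}"]) (auto simp: pcoeff_pmonom)
qed

lemma prod_pvar_num_cycles:
  assumes "\<sigma> permutes {1..n}"
  shows "(\<Prod>i=1..n. pvar i ^ num_cycles {1..n} \<sigma> i) = pmonom (1 :: 'a :: comm_ring_1) (cycle_type {1..n} \<sigma>)"
proof -
  have "(\<Prod>i=1..n. pvar i ^ num_cycles {1..n} \<sigma> i :: 'a pseries)
      = (\<Prod>k\<in>#cycle_type {1..n} \<sigma>. pmonom 1 {#k#})"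
    using assms by (subst prod_num_cycles[of _ _ n]) (simp_all add: num_cycles_def cycles_def pvar_def)
  then show ?thesis by (simp add: prod_mset_pmonom)
qed

text \<open>Only permutations of \<open>sum_mset m\<close> points can have cycle type \<open>m\<close>.\<close>

lemma pcoeff_cycle_index:
  defines "term F n m \<equiv> fps_const (1 / fact n) * (\<Sum>\<sigma> | \<sigma> permutes {1..n} \<and> cycle_type {1..n} \<sigma> = m.
      \<Sum>s | s \<in> structures F {1..n} \<and> relabel F \<sigma> s = s. weight F s)"
  shows "pcoeff (cycle_index F) m = term F (sum_mset m) m"
proof -
  have "pcoeff (cycle_index F) m = Sum_any (\<lambda>n. term F n m)"
    unfolding cycle_index_def pcoeff_formal_sum
  proof (intro arg_cong[where f = Sum_any] ext)
    fix n
    let ?S = "\<lambda>\<sigma>. \<Sum>s | s \<in> structures F {1..n} \<and> relabel F \<sigma> s = s. weight F s"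
    have "(\<Sum>\<sigma> | \<sigma> permutes {1..n}. pcoeff (pconst (?S \<sigma>) * (\<Prod>i=1..n. pvar i ^ num_cycles {1..n} \<sigma> i)) m)
        = (\<Sum>\<sigma> | \<sigma> permutes {1..n}. if cycle_type {1..n} \<sigma> = m then ?S \<sigma> else 0)"
      by (rule sum.cong) (auto simp: pcoeff_pconst_mult prod_pvar_num_cycles pcoeff_pmonom simp del: One_nat_def)
    also have "\<dots> = (\<Sum>\<sigma> | \<sigma> permutes {1..n} \<and> cycle_type {1..n} \<sigma> = m. ?S \<sigma>)"
      by (subst sum.inter_filter[symmetric]) (auto simp: finite_permutations conj_commute)
    finally show "pcoeff (pconst (fps_const (1 / fact n)) * (\<Sum>\<sigma> | \<sigma> permutes {1..n}.
        pconst (?S \<sigma>) * (\<Prod>i=1..n. pvar i ^ num_cycles {1..n} \<sigma> i))) m = term F n m"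
      by (simp add: pcoeff_pconst_mult pcoeff_sum term_def)
  qed
  also have "\<dots> = term F (sum_mset m) m"
  proof (rule Sum_any_single)
    fix n assume "n \<noteq> sum_mset m"
    then have "{\<sigma>. \<sigma> permutes {1..n} \<and> cycle_type {1..n} \<sigma> = m} = {}"
      using sum_mset_cycle_type[of "{1..n}"] by auto
    then show "term F n m = 0" by (simp only: term_def) simp
  qed
  finally show ?thesis .
qed

lemma zero_notin_cycle_type: "finite A \<Longrightarrow> \<sigma> permutes A \<Longrightarrow> 0 \<notin># cycle_type A \<sigma>"
  using cycle_props(2,3)[of A \<sigma>] finite_cycles[of A \<sigma>] by (auto simp: cycle_type_def)

text \<open>All permutations contributing to \<open>m\<close> have cycle type \<open>m\<close>, so
  the product leaves the sum over permutations; what is left counts fixed rooted trees and is the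
  coefficient of \<open>PreLie\<close>.\<close>

lemma pcoeff_hollow:
  "(1 + fps_X) * pcoeff (cycle_index hollow_PreLie_species) m = pcoeff PreLie m * (\<Prod>k\<in>#m. 1 + fps_X ^ k)"
proof -
  let ?I = "{1..sum_mset m}"
  let ?S = "{\<sigma>. \<sigma> permutes ?I \<and> cycle_type ?I \<sigma> = m}"
  let ?T = "\<lambda>\<sigma>. {T \<in> rooted_trees ?I. relabel_rooted_tree \<sigma> T = T}"
  let ?h = "\<lambda>\<sigma>. \<Sum>s | s \<in> hollow_PreLie_hypertrees ?I \<and> relabel_decorated_hypertree \<sigma> s = s.
      (fps_X :: rat fps) ^ (card (fst s) - 1)"
  let ?c = "fps_const (1 / fact (sum_mset m)) :: rat fps"
  have "pcoeff (cycle_index hollow_PreLie_species) m = ?c * (\<Sum>\<sigma>\<in>?S. ?h \<sigma>)"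
    by (simp add: pcoeff_cycle_index hollow_PreLie_species_def case_prod_beta del: One_nat_def)
  then have "(1 + fps_X) * pcoeff (cycle_index hollow_PreLie_species) m
      = ?c * (\<Sum>\<sigma>\<in>?S. (1 + fps_X) * ?h \<sigma>)"
    by (simp only: mult.left_commute[of "1 + fps_X" ?c] sum_distrib_left[of "1 + fps_X"])
  also have "(\<Sum>\<sigma>\<in>?S. (1 + fps_X) * ?h \<sigma>) = (\<Sum>\<sigma>\<in>?S. of_nat (card (?T \<sigma>)) * (\<Prod>k\<in>#m. 1 + fps_X ^ k))"
  proof (rule sum.cong)
    fix \<sigma> assume "\<sigma> \<in> ?S"
    then show "(1 + fps_X) * ?h \<sigma> = of_nat (card (?T \<sigma>)) * (\<Prod>k\<in>#m. 1 + fps_X ^ k)"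
      using sum_fixed_hollow[of ?I \<sigma> "fps_X :: rat fps"] by simp
  qed simp
  also have "\<dots> = (\<Sum>\<sigma>\<in>?S. of_nat (card (?T \<sigma>))) * (\<Prod>k\<in>#m. 1 + fps_X ^ k)"
    by (rule sum_distrib_right[symmetric])
  also have "?c * \<dots> = pcoeff PreLie m * (\<Prod>k\<in>#m. 1 + fps_X ^ k)"
    by (simp add: PreLie_def pcoeff_cycle_index PreLie_species_def mult.assoc del: One_nat_def)
  finally show ?thesis .
qed

lemma pcoeff_PreLie_eq_0: "0 \<in># m \<Longrightarrow> pcoeff PreLie m = 0"
proof -
  assume zero: "0 \<in># m"
  have "{\<sigma>. \<sigma> permutes {1..sum_mset m} \<and> cycle_type {1..sum_mset m} \<sigma> = m} = {}"
  proof (rule equals0I)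
    fix \<sigma> assume "\<sigma> \<in> {\<sigma>. \<sigma> permutes {1..sum_mset m} \<and> cycle_type {1..sum_mset m} \<sigma> = m}"
    then have \<sigma>: "\<sigma> permutes {1..sum_mset m}" and eq: "cycle_type {1..sum_mset m} \<sigma> = m" by auto
    show False using zero_notin_cycle_type[OF _ \<sigma>] zero unfolding eq by simp
  qed
  then show ?thesis by (simp only: PreLie_def pcoeff_cycle_index sum.empty mult_zero_right)
qed

text \<open>Leaving \<open>c 0\<close> arbitrary makes both forms of the substitution instances of
  one statement; \<open>pcoeff_PreLie_eq_0\<close> disposes of the monomials in which it
  occurs.\<close>

lemma cycle_index_hollow:
  assumes "\<And>k. k > 0 \<Longrightarrow> c k = 1 + fps_X ^ k"
  shows "cycle_index hollow_PreLie_species = pconst (1 / (1 + fps_X)) * psubst PreLie (\<lambda>k. pmonom (c k) {#k#})"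
proof (rule pseries_eqI)
  fix m
  have "pcoeff PreLie m * (\<Prod>k\<in>#m. c k) = pcoeff PreLie m * (\<Prod>k\<in>#m. 1 + fps_X ^ k)"
  proof (cases "0 \<in># m")
    case False
    then have "k > 0" if "k \<in># m" for k using that by (cases k) auto
    then have "image_mset c m = image_mset (\<lambda>k. 1 + fps_X ^ k) m"
      using assms by (intro image_mset_cong) auto
    then show ?thesis by simp
  qed (simp add: pcoeff_PreLie_eq_0)
  \<comment> \<open>The constant term of \<open>1 + fps_X\<close> is 1, so this is division by a
    unit.\<close>
  moreover have "1 / (1 + fps_X) * (1 + fps_X) = (1 :: rat fps)"
    by (simp add: fps_divide_unit inverse_mult_eq_1)
  then have "1 / (1 + fps_X) * ((1 + fps_X) * pcoeff (cycle_index hollow_PreLie_species) m)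
      = pcoeff (cycle_index hollow_PreLie_species) m"
    by (metis mult.assoc mult_1_left)
  ultimately show "pcoeff (cycle_index hollow_PreLie_species) m
      = pcoeff (pconst (1 / (1 + fps_X)) * psubst PreLie (\<lambda>k. pmonom (c k) {#k#})) m"
    by (simp only: pcoeff_pconst_mult pcoeff_psubst_monomials pcoeff_hollow)
qed

text \<open>
  At \<open>k = 0\<close>, where \<^const>\<open>adams\<close> composes with the non-nilpotent \<open>fps_X ^ 0\<close>, the two
  substitutions differ; this is harmless because no monomial of a cycle index series has index 0.
\<close>

theorem proposition3p12:
  "cycle_index hollow_PreLie_species
     = pconst (1 / (1 + fps_X)) * (PreLie \<circ>\<^sub>p (pconst (1 + fps_X) * pvar 1)) \<and>
   cycle_index hollow_PreLie_species
     = pconst (1 / (1 + fps_X)) * psubst PreLie (\<lambda>k. pconst (1 + fps_X ^ k) * pvar k)"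
proof
  have "fps_compose (1 + fps_X) (fps_X ^ k) = (1 + fps_X ^ k :: rat fps)" if "k > 0" for k
    using that by (simp add: fps_compose_add_distrib fps_X_power_nth)
  then show "cycle_index hollow_PreLie_species
     = pconst (1 / (1 + fps_X)) * (PreLie \<circ>\<^sub>p (pconst (1 + fps_X) * pvar 1))"
    unfolding plethysm_def pconst_mult_pvar adams_pmonom_1 by (rule cycle_index_hollow)
  show "cycle_index hollow_PreLie_species
     = pconst (1 / (1 + fps_X)) * psubst PreLie (\<lambda>k. pconst (1 + fps_X ^ k) * pvar k)"
    unfolding pconst_mult_pvar by (rule cycle_index_hollow) simp
qed

end
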